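(* Let $D$ be an uncountable Dedekind domain whose set of maximal ideals is countable. Then $U(D)$ is uncountable. In particular, $D$ is submaximal.
   Context: All rings are commutative with $1\neq 0$, and a subring of a ring contains the identity of that ring. A maximal subring of $R$ is a proper subring $S\subsetneq R$ such that there is no subring strictly between $S$ and $R$; $R$ is called submaximal if it has at least one maximal subring. $U(D)$ is the group of units of $D$. "Countable" means finite or countably infinite. *)

theory Defs
  imports "HOL-Algebra.Polynomials" "HOL-Library.Countable_Set"
begin

section \<open>The field of fractions of a domain\<close>

definition fraction_rel :: "('a, 'm) ring_scheme \<Rightarrow> (('a \<times> 'a) \<times> ('a \<times> 'a)) set"
  where "fraction_rel D =
    {((a, b), (c, d)). a \<in> carrier D \<and> b \<in> carrier D - {\<zero>\<^bsub>D\<^esub>} \<and>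
                       c \<in> carrier D \<and> d \<in> carrier D - {\<zero>\<^bsub>D\<^esub>} \<and>
                       a \<otimes>\<^bsub>D\<^esub> d = c \<otimes>\<^bsub>D\<^esub> b}"

definition fraction :: "('a, 'm) ring_scheme \<Rightarrow> 'a \<Rightarrow> 'a \<Rightarrow> ('a \<times> 'a) set"
  where "fraction D a b = fraction_rel D `` {(a, b)}"

text \<open>
  The operations lift those on representatives to classes: the unions below run over
  copies of one set, as shown in \<open>fraction_mult\<close> and \<open>fraction_add\<close>.
\<close>

definition fraction_field :: "('a, 'm) ring_scheme \<Rightarrow> ('a \<times> 'a) set ring"
  where "fraction_field D =
    \<lparr> carrier = (carrier D \<times> (carrier D - {\<zero>\<^bsub>D\<^esub>})) // fraction_rel D,
      mult = (\<lambda>p q. \<Union>(a, b)\<in>p. \<Union>(c, d)\<in>q. fraction D (a \<otimes>\<^bsub>D\<^esub> c) (b \<otimes>\<^bsub>D\<^esub> d)),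
      one = fraction D \<one>\<^bsub>D\<^esub> \<one>\<^bsub>D\<^esub>,
      zero = fraction D \<zero>\<^bsub>D\<^esub> \<one>\<^bsub>D\<^esub>,
      add = (\<lambda>p q. \<Union>(a, b)\<in>p. \<Union>(c, d)\<in>q.
               fraction D ((a \<otimes>\<^bsub>D\<^esub> d) \<oplus>\<^bsub>D\<^esub> (c \<otimes>\<^bsub>D\<^esub> b)) (b \<otimes>\<^bsub>D\<^esub> d)) \<rparr>"

definition to_fraction :: "('a, 'm) ring_scheme \<Rightarrow> 'a \<Rightarrow> ('a \<times> 'a) set"
  where "to_fraction D a = fraction D a \<one>\<^bsub>D\<^esub>"

lemma UN2_const:
  assumes "(a, b) \<in> A" "(c, d) \<in> B"
    and "\<And>a b c d. (a, b) \<in> A \<Longrightarrow> (c, d) \<in> B \<Longrightarrow> f a b c d = F"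
  shows "(\<Union>(a, b)\<in>A. \<Union>(c, d)\<in>B. f a b c d) = F"
proof (intro equalityI subsetI)
  fix x assume "x \<in> (\<Union>(a, b)\<in>A. \<Union>(c, d)\<in>B. f a b c d)"
  then obtain a b c d where "(a, b) \<in> A" "(c, d) \<in> B" "x \<in> f a b c d"
    by blast
  then show "x \<in> F" using assms(3) by blast
next
  fix x assume "x \<in> F"
  then have "x \<in> f a b c d" using assms by blast
  then show "x \<in> (\<Union>(a, b)\<in>A. \<Union>(c, d)\<in>B. f a b c d)"
    using assms(1,2) by blast
qed

context domain
begin

lemma nonzero_mult:
  "b \<in> carrier R - {\<zero>} \<Longrightarrow> d \<in> carrier R - {\<zero>} \<Longrightarrow> b \<otimes> d \<in> carrier R - {\<zero>}"
  using integral by auto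

lemma equiv_fraction_rel: "equiv (carrier R \<times> (carrier R - {\<zero>})) (fraction_rel R)"
proof (rule equivI)
  show "fraction_rel R \<subseteq> (carrier R \<times> (carrier R - {\<zero>})) \<times> (carrier R \<times> (carrier R - {\<zero>}))"
    by (auto simp: fraction_rel_def)
  show "refl_on (carrier R \<times> (carrier R - {\<zero>})) (fraction_rel R)"
    by (auto simp: refl_on_def fraction_rel_def)
  show "sym (fraction_rel R)"
    by (auto simp: sym_def fraction_rel_def)
  show "trans (fraction_rel R)"
  proof (rule transI, clarsimp simp: fraction_rel_def)
    fix a b c d e f
    assume c: "a \<in> carrier R" "b \<in> carrier R" "c \<in> carrier R" "d \<in> carrier R"
      "e \<in> carrier R" "f \<in> carrier R" and "d \<noteq> \<zero>"
      and 1: "a \<otimes> d = c \<otimes> b" and 2: "c \<otimes> f = e \<otimes> d"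
    have "d \<otimes> (a \<otimes> f) = (a \<otimes> d) \<otimes> f" using c by (simp add: m_ac)
    also have "\<dots> = (c \<otimes> f) \<otimes> b" using c 1 by (simp add: m_ac)
    also have "\<dots> = d \<otimes> (e \<otimes> b)" using c by (simp add: 2 m_ac)
    finally show "a \<otimes> f = e \<otimes> b"
      using m_lcancel[of d "a \<otimes> f" "e \<otimes> b"] c \<open>d \<noteq> \<zero>\<close> by simp
  qed
qed

lemma fraction_eq_iff:
  assumes "a \<in> carrier R" "b \<in> carrier R - {\<zero>}" "c \<in> carrier R" "d \<in> carrier R - {\<zero>}"
  shows "fraction R a b = fraction R c d \<longleftrightarrow> a \<otimes> d = c \<otimes> b"
proof -
  have "fraction R a b = fraction R c d \<longleftrightarrow> ((a, b), (c, d)) \<in> fraction_rel R"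
    unfolding fraction_def using eq_equiv_class_iff[OF equiv_fraction_rel] assms by simp
  then show ?thesis using assms by (simp add: fraction_rel_def)
qed

lemma fraction_in_carrier [simp]:
  "a \<in> carrier R \<Longrightarrow> b \<in> carrier R - {\<zero>} \<Longrightarrow> fraction R a b \<in> carrier (fraction_field R)"
  by (auto simp: fraction_field_def fraction_def intro!: quotientI)

lemma fraction_cases:
  assumes "x \<in> carrier (fraction_field R)"
  obtains a b where "a \<in> carrier R" "b \<in> carrier R - {\<zero>}" "x = fraction R a b"
  using assms by (auto simp: fraction_field_def fraction_def elim!: quotientE)

lemma fraction_mult:
  assumes "a \<in> carrier R" "b \<in> carrier R - {\<zero>}" "c \<in> carrier R" "d \<in> carrier R - {\<zero>}"
  shows "fraction R a b \<otimes>\<^bsub>fraction_field R\<^esub> fraction R c d = fraction R (a \<otimes> c) (b \<otimes> d)"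
proof -
  have "fraction R (a' \<otimes> c') (b' \<otimes> d') = fraction R (a \<otimes> c) (b \<otimes> d)"
    if "(a', b') \<in> fraction R a b" "(c', d') \<in> fraction R c d" for a' b' c' d'
  proof -
    have h: "a' \<in> carrier R" "b' \<in> carrier R - {\<zero>}" "c' \<in> carrier R" "d' \<in> carrier R - {\<zero>}"
      and e: "a \<otimes> b' = a' \<otimes> b" "c \<otimes> d' = c' \<otimes> d"
      using that by (auto simp: fraction_def fraction_rel_def)
    have "(a' \<otimes> c') \<otimes> (b \<otimes> d) = (a' \<otimes> b) \<otimes> (c' \<otimes> d)" using assms h by (simp add: m_ac)
    also have "\<dots> = (a \<otimes> b') \<otimes> (c \<otimes> d')" by (simp only: e)
    also have "\<dots> = (a \<otimes> c) \<otimes> (b' \<otimes> d')" using assms h by (simp add: m_ac)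
    finally show ?thesis using assms h nonzero_mult by (simp add: fraction_eq_iff)
  qed
  moreover have "(a, b) \<in> fraction R a b" "(c, d) \<in> fraction R c d"
    using assms by (auto simp: fraction_def fraction_rel_def)
  ultimately show ?thesis
    unfolding fraction_field_def monoid.simps ring.simps by (intro UN2_const)
qed

lemma fraction_add:
  assumes "a \<in> carrier R" "b \<in> carrier R - {\<zero>}" "c \<in> carrier R" "d \<in> carrier R - {\<zero>}"
  shows "fraction R a b \<oplus>\<^bsub>fraction_field R\<^esub> fraction R c d
       = fraction R ((a \<otimes> d) \<oplus> (c \<otimes> b)) (b \<otimes> d)"
proof -
  have "fraction R ((a' \<otimes> d') \<oplus> (c' \<otimes> b')) (b' \<otimes> d') = fraction R ((a \<otimes> d) \<oplus> (c \<otimes> b)) (b \<otimes> d)"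
    if "(a', b') \<in> fraction R a b" "(c', d') \<in> fraction R c d" for a' b' c' d'
  proof -
    have h: "a' \<in> carrier R" "b' \<in> carrier R - {\<zero>}" "c' \<in> carrier R" "d' \<in> carrier R - {\<zero>}"
      and e: "a \<otimes> b' = a' \<otimes> b" "c \<otimes> d' = c' \<otimes> d"
      using that by (auto simp: fraction_def fraction_rel_def)
    have "((a' \<otimes> d') \<oplus> (c' \<otimes> b')) \<otimes> (b \<otimes> d)
        = (a' \<otimes> b) \<otimes> (d \<otimes> d') \<oplus> (c' \<otimes> d) \<otimes> (b \<otimes> b')"
      using assms h by (simp add: m_ac l_distr r_distr)
    also have "\<dots> = (a \<otimes> b') \<otimes> (d \<otimes> d') \<oplus> (c \<otimes> d') \<otimes> (b \<otimes> b')"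
      by (simp only: e)
    also have "\<dots> = ((a \<otimes> d) \<oplus> (c \<otimes> b)) \<otimes> (b' \<otimes> d')"
      using assms h by (simp add: m_ac l_distr r_distr)
    finally show ?thesis using assms h nonzero_mult by (simp add: fraction_eq_iff)
  qed
  moreover have "(a, b) \<in> fraction R a b" "(c, d) \<in> fraction R c d"
    using assms by (auto simp: fraction_def fraction_rel_def)
  ultimately show ?thesis
    unfolding fraction_field_def monoid.simps ring.simps by (intro UN2_const)
qed

lemma fraction_zero: "\<zero>\<^bsub>fraction_field R\<^esub> = fraction R \<zero> \<one>"
  and fraction_one: "\<one>\<^bsub>fraction_field R\<^esub> = fraction R \<one> \<one>"
  by (simp_all add: fraction_field_def)

lemmas fraction_simps = fraction_mult fraction_add fraction_zero fraction_one fraction_eq_iff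

lemma cring_fraction_field: "cring (fraction_field R)"
proof (rule cringI)
  show "abelian_group (fraction_field R)"
  proof (rule abelian_groupI)
    fix x y assume "x \<in> carrier (fraction_field R)" "y \<in> carrier (fraction_field R)"
    then show "x \<oplus>\<^bsub>fraction_field R\<^esub> y \<in> carrier (fraction_field R)"
      using nonzero_mult by (elim fraction_cases) (simp add: fraction_simps)
  next
    show "\<zero>\<^bsub>fraction_field R\<^esub> \<in> carrier (fraction_field R)"
      by (simp add: fraction_zero)
  next
    fix x y z
    assume "x \<in> carrier (fraction_field R)" "y \<in> carrier (fraction_field R)"
      "z \<in> carrier (fraction_field R)"
    then show "x \<oplus>\<^bsub>fraction_field R\<^esub> y \<oplus>\<^bsub>fraction_field R\<^esub> z
             = x \<oplus>\<^bsub>fraction_field R\<^esub> (y \<oplus>\<^bsub>fraction_field R\<^esub> z)"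
      using nonzero_mult
      by (elim fraction_cases) (simp add: fraction_simps m_ac a_ac l_distr r_distr)
  next
    fix x y assume "x \<in> carrier (fraction_field R)" "y \<in> carrier (fraction_field R)"
    then show "x \<oplus>\<^bsub>fraction_field R\<^esub> y = y \<oplus>\<^bsub>fraction_field R\<^esub> x"
      using nonzero_mult by (elim fraction_cases) (simp add: fraction_simps m_ac a_ac)
  next
    fix x assume "x \<in> carrier (fraction_field R)"
    then show "\<zero>\<^bsub>fraction_field R\<^esub> \<oplus>\<^bsub>fraction_field R\<^esub> x = x"
      by (elim fraction_cases) (simp add: fraction_simps)
  next
    fix x assume "x \<in> carrier (fraction_field R)"
    then obtain a b where ab: "a \<in> carrier R" "b \<in> carrier R - {\<zero>}" "x = fraction R a b"
      by (rule fraction_cases)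
    have "fraction R (\<ominus> a) b \<oplus>\<^bsub>fraction_field R\<^esub> x = \<zero>\<^bsub>fraction_field R\<^esub>"
      using ab nonzero_mult by (simp add: fraction_simps l_minus l_neg)
    then show "\<exists>y\<in>carrier (fraction_field R). y \<oplus>\<^bsub>fraction_field R\<^esub> x = \<zero>\<^bsub>fraction_field R\<^esub>"
      using ab by (intro bexI[of _ "fraction R (\<ominus> a) b"]) auto
  qed
next
  show "comm_monoid (fraction_field R)"
  proof (rule comm_monoidI)
    fix x y assume "x \<in> carrier (fraction_field R)" "y \<in> carrier (fraction_field R)"
    then show "x \<otimes>\<^bsub>fraction_field R\<^esub> y \<in> carrier (fraction_field R)"
      using nonzero_mult by (elim fraction_cases) (simp add: fraction_simps)
  next
    show "\<one>\<^bsub>fraction_field R\<^esub> \<in> carrier (fraction_field R)"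
      by (simp add: fraction_one)
  next
    fix x y z
    assume "x \<in> carrier (fraction_field R)" "y \<in> carrier (fraction_field R)"
      "z \<in> carrier (fraction_field R)"
    then show "x \<otimes>\<^bsub>fraction_field R\<^esub> y \<otimes>\<^bsub>fraction_field R\<^esub> z
             = x \<otimes>\<^bsub>fraction_field R\<^esub> (y \<otimes>\<^bsub>fraction_field R\<^esub> z)"
      using nonzero_mult by (elim fraction_cases) (simp add: fraction_simps m_ac)
  next
    fix x assume "x \<in> carrier (fraction_field R)"
    then show "\<one>\<^bsub>fraction_field R\<^esub> \<otimes>\<^bsub>fraction_field R\<^esub> x = x"
      by (elim fraction_cases) (simp add: fraction_simps)
  next
    fix x y assume "x \<in> carrier (fraction_field R)" "y \<in> carrier (fraction_field R)"
    then show "x \<otimes>\<^bsub>fraction_field R\<^esub> y = y \<otimes>\<^bsub>fraction_field R\<^esub> x"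
      by (elim fraction_cases) (simp add: fraction_simps m_ac)
  qed
next
  fix x y z
  assume "x \<in> carrier (fraction_field R)" "y \<in> carrier (fraction_field R)"
    "z \<in> carrier (fraction_field R)"
  then show "(x \<oplus>\<^bsub>fraction_field R\<^esub> y) \<otimes>\<^bsub>fraction_field R\<^esub> z
           = x \<otimes>\<^bsub>fraction_field R\<^esub> z \<oplus>\<^bsub>fraction_field R\<^esub> y \<otimes>\<^bsub>fraction_field R\<^esub> z"
    using nonzero_mult
    by (elim fraction_cases) (simp add: fraction_simps m_ac a_ac l_distr r_distr)
qed

theorem field_fraction_field: "field (fraction_field R)"
proof (rule cring.cring_fieldI2[OF cring_fraction_field])
  show "\<zero>\<^bsub>fraction_field R\<^esub> \<noteq> \<one>\<^bsub>fraction_field R\<^esub>"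
    by (simp add: fraction_simps)
next
  fix x assume "x \<in> carrier (fraction_field R)" and "x \<noteq> \<zero>\<^bsub>fraction_field R\<^esub>"
  then obtain a b where ab: "a \<in> carrier R - {\<zero>}" "b \<in> carrier R - {\<zero>}" "x = fraction R a b"
    by (elim fraction_cases) (auto simp: fraction_simps)
  then have "x \<otimes>\<^bsub>fraction_field R\<^esub> fraction R b a = \<one>\<^bsub>fraction_field R\<^esub>"
    using nonzero_mult by (simp add: fraction_simps m_comm)
  then show "\<exists>y\<in>carrier (fraction_field R). x \<otimes>\<^bsub>fraction_field R\<^esub> y = \<one>\<^bsub>fraction_field R\<^esub>"
    using ab by (intro bexI[of _ "fraction R b a"]) auto
qed

lemma to_fraction_hom: "to_fraction R \<in> ring_hom R (fraction_field R)"
  by (rule ring_hom_memI) (simp_all add: to_fraction_def fraction_simps)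

lemma inj_on_to_fraction: "inj_on (to_fraction R) (carrier R)"
  by (rule inj_onI) (simp add: to_fraction_def fraction_simps)

lemma fraction_quotient:
  assumes "a \<in> carrier R" "b \<in> carrier R - {\<zero>}"
  shows "fraction R a b \<otimes>\<^bsub>fraction_field R\<^esub> to_fraction R b = to_fraction R a"
  using assms by (simp add: to_fraction_def fraction_simps m_comm)

end


section \<open>Integral elements and Dedekind domains\<close>

text \<open>Polynomials are lists of coefficients with the leading coefficient first.\<close>

definition integral_over :: "('a, 'm) ring_scheme \<Rightarrow> 'a set \<Rightarrow> 'a \<Rightarrow> bool"
  where "integral_over K A x \<longleftrightarrow>
    (\<exists>p. polynomial\<^bsub>K\<^esub> A p \<and> p \<noteq> [] \<and> lead_coeff p = \<one>\<^bsub>K\<^esub> \<and> ring.eval K p x = \<zero>\<^bsub>K\<^esub>)"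

definition integrally_closed :: "('a, 'm) ring_scheme \<Rightarrow> bool"
  where "integrally_closed D \<longleftrightarrow>
    (\<forall>x \<in> carrier (fraction_field D).
       integral_over (fraction_field D) (to_fraction D ` carrier D) x
         \<longrightarrow> x \<in> to_fraction D ` carrier D)"

text \<open>Fields are not excluded: the zero ideal is not required to be non-maximal.\<close>

locale dedekind_domain = noetherian_domain D for D (structure) +
  assumes integrally_closed: "integrally_closed D"
    and nonzero_prime_maximal: "\<lbrakk> primeideal P D; P \<noteq> {\<zero>} \<rbrakk> \<Longrightarrow> maximalideal P D"


section \<open>Maximal subrings\<close>

definition maximal_subring :: "'a set \<Rightarrow> ('a, 'm) ring_scheme \<Rightarrow> bool"
  where "maximal_subring S R \<longleftrightarrow>
    subring S R \<and> S \<subset> carrier R \<and> \<not> (\<exists>T. subring T R \<and> S \<subset> T \<and> T \<subset> carrier R)"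

definition submaximal :: "('a, 'm) ring_scheme \<Rightarrow> bool"
  where "submaximal R \<longleftrightarrow> (\<exists>S. maximal_subring S R)"

end

theory Submission
  imports Defs "HOL-Algebra.Finite_Extensions"
begin

text \<open>
  Every nonzero maximal ideal \<open>P\<close> of \<open>D\<close> is invertible, so an ideal \<open>I \<subseteq> P\<close> is determined by
  \<open>P\<close> and the ideal quotient \<open>I : P\<close>, which is strictly larger than \<open>I \<noteq> 0\<close>. By Noetherian
  induction every nonzero ideal is reached from \<open>D\<close> in finitely many steps, each given by a maximal
  ideal; so countably many maximal ideals leave only countably many ideals. As the generators of a
  principal ideal differ by units, an uncountable \<open>D\<close> has uncountably many units.

  Hence some unit \<open>x\<close> is transcendental over the prime subring. In the field of fractions \<open>K\<close> let
  \<open>L\<close> be maximal among the subrings over which \<open>x\<close> is transcendental, and \<open>V\<close> maximal among the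
  subrings that contain \<open>L[x]\<close> but not \<open>1/x\<close>. Then \<open>L\<close> is a field, \<open>K\<close> is algebraic over
  \<open>L(x)\<close> and \<open>V\<close> is integrally closed, so every element of \<open>K\<close> is moved into \<open>V\<close> by a power of
  \<open>x\<close>. A subring of \<open>D\<close> that contains \<open>V \<inter> D\<close> and is maximal among those without \<open>1/x\<close>
  is therefore a maximal subring: a larger one contains \<open>1/x\<close>, hence all of \<open>D\<close>.
\<close>

section \<open>Polynomial expressions as finite sums\<close>

lemma (in abelian_group) finsum_swap_atMost:
  assumes "\<And>i j. \<lbrakk>i \<le> n; j \<le> m\<rbrakk> \<Longrightarrow> g i j \<in> carrier G"
  shows "(\<Oplus>i\<in>{..n::nat}. \<Oplus>j\<in>{..m::nat}. g i j) = (\<Oplus>j\<in>{..m}. \<Oplus>i\<in>{..n}. g i j)"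
  using assms
proof (induction n)
  case 0
  then have "(\<Oplus>j\<in>{..m}. \<Oplus>i\<in>{..0}. g i j) = (\<Oplus>j\<in>{..m}. g 0 j)"
    by (intro finsum_cong') auto
  then show ?case using 0 by (simp add: Pi_def)
next
  case (Suc n)
  have "(\<Oplus>j\<in>{..m}. \<Oplus>i\<in>{..Suc n}. g i j) = (\<Oplus>j\<in>{..m}. g (Suc n) j \<oplus> (\<Oplus>i\<in>{..n}. g i j))"
    using Suc.prems by (intro finsum_cong') (auto simp: Pi_def finsum_Suc intro!: finsum_closed a_closed)
  also have "\<dots> = (\<Oplus>j\<in>{..m}. g (Suc n) j) \<oplus> (\<Oplus>j\<in>{..m}. \<Oplus>i\<in>{..n}. g i j)"
    using Suc.prems by (intro finsum_addf) (auto simp: Pi_def intro!: finsum_closed)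
  also have "\<dots> = (\<Oplus>i\<in>{..Suc n}. \<Oplus>j\<in>{..m}. g i j)"
    using Suc.prems Suc.IH by (subst finsum_Suc) (auto simp: Pi_def intro!: finsum_closed)
  finally show ?case by simp
qed

text \<open>Links list polynomials, whose leading coefficient comes first, to finite sums;
  \<open>rev [0..<n]\<close> runs through the exponents in decreasing order.\<close>

lemma (in ring) eval_map_upt:
  assumes "f \<in> {..<n} \<rightarrow> carrier R" "x \<in> carrier R"
  shows "eval (map f (rev [0..<n])) x = (\<Oplus>i\<in>{..<n}. f i \<otimes> x [^] i)"
  using assms
proof (induction n)
  case (Suc n)
  then show ?case
    by (simp add: Pi_def lessThan_Suc)
qed simp

lemma (in cring) idealI_mult:
  assumes "I \<subseteq> carrier R" "\<zero> \<in> I"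
    and "\<And>x y. \<lbrakk>x \<in> I; y \<in> I\<rbrakk> \<Longrightarrow> x \<oplus> y \<in> I"
    and "\<And>a x. \<lbrakk>a \<in> carrier R; x \<in> I\<rbrakk> \<Longrightarrow> a \<otimes> x \<in> I"
  shows "ideal I R"
proof (rule idealI[OF ring_axioms])
  have "\<ominus> x \<in> I" if "x \<in> I" for x
    using assms(4)[of "\<ominus> \<one>" x] that assms(1) by (auto simp: l_minus)
  then show "subgroup I (add_monoid R)"
    using assms by (intro add.subgroupI) auto
  show "x \<otimes> a \<in> I" if "a \<in> I" "x \<in> carrier R" for a x
    using that assms(4) by blast
  show "a \<otimes> x \<in> I" if "a \<in> I" "x \<in> carrier R" for a x
    using that assms(1) assms(4)[of x a] m_comm[of a x] by auto
qed

lemmas ideal_memE = ideal.Icarr additive_subgroup.zero_closed[OF ideal.axioms(1)]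
  additive_subgroup.a_closed[OF ideal.axioms(1)] ideal.I_l_closed

section \<open>Colon ideals\<close>

text \<open>The ideal quotient \<open>I : S\<close>. For \<open>a \<noteq> \<zero>\<close> in an
  ideal \<open>P\<close> of a domain, \<open>colon R (PIdl a) P\<close> is \<open>a\<close> times
  the inverse of \<open>P\<close>, so that fractional ideals are handled inside the ring.\<close>

definition colon :: "('a, 'm) ring_scheme \<Rightarrow> 'a set \<Rightarrow> 'a set \<Rightarrow> 'a set"
  where "colon R I S = {d \<in> carrier R. \<forall>s\<in>S. d \<otimes>\<^bsub>R\<^esub> s \<in> I}"

lemma (in cring) ideal_colon:
  assumes "ideal I R" "S \<subseteq> carrier R"
  shows "ideal (colon R I S) R"
  using assms
  by (intro idealI_mult)
    (auto simp: colon_def l_distr m_assoc subset_iff intro: ideal_memE)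

lemma (in cring) subset_colon:
  assumes "ideal I R" "S \<subseteq> carrier R"
  shows "I \<subseteq> colon R I S"
  using assms by (auto simp: colon_def intro: ideal.Icarr ideal.I_r_closed)

text \<open>In a Noetherian ring the union of a nonempty chain of ideals is a member of the chain,
  so Zorn's lemma applies to every nonempty family of ideals.\<close>

lemma (in noetherian_ring) maximal_ideal_of_family:
  assumes "F \<noteq> {}" "\<And>I. I \<in> F \<Longrightarrow> ideal I R"
  shows "\<exists>M\<in>F. \<forall>I\<in>F. M \<subseteq> I \<longrightarrow> I = M"
proof -
  have "\<Union>C \<in> F" if "C \<noteq> {}" "subset.chain F C" for C
    using ideal_chain_is_trivial[of C] that assms(2) by (auto simp: pred_on.chain_def subset_iff)
  then show ?thesis
    by (rule subset_Zorn_nonempty[OF assms(1)])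
qed

lemma (in noetherian_ring) exists_maximalideal:
  assumes I: "ideal I R" "I \<noteq> carrier R"
  obtains P where "maximalideal P R" "I \<subseteq> P"
proof -
  let ?F = "{J. ideal J R \<and> I \<subseteq> J \<and> J \<noteq> carrier R}"
  have "\<exists>M\<in>?F. \<forall>J\<in>?F. M \<subseteq> J \<longrightarrow> J = M"
    by (rule maximal_ideal_of_family) (use I in auto)
  then obtain M where M: "M \<in> ?F" "\<forall>J\<in>?F. M \<subseteq> J \<longrightarrow> J = M" by (rule bexE)
  have "maximalideal M R"
  proof (rule maximalidealI)
    fix J assume J: "ideal J R" "M \<subseteq> J" "J \<subseteq> carrier R"
    show "J = M \<or> J = carrier R"
    proof (rule disjCI)
      assume "J \<noteq> carrier R"
      then have "J \<in> ?F" using J M(1) by blast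
      then show "J = M" using M(2) J(2) by simp
    qed
  qed (use M(1) in auto)
  then show ?thesis using M that by blast
qed

text \<open>This finds an associated prime of the quotient by \<open>a\<close> inside
  \<open>P\<close>: a maximal member among the colon ideals of single elements \<open>y\<close> that
  are contained in \<open>P\<close>.\<close>

lemma (in noetherian_domain) exists_prime_colon:
  assumes P: "primeideal P R" and a: "a \<in> P"
  obtains y where "y \<in> carrier R" "y \<notin> PIdl a" "primeideal (colon R (PIdl a) {y}) R"
    "a \<in> colon R (PIdl a) {y}" "colon R (PIdl a) {y} \<subseteq> P"
proof -
  interpret P: primeideal P R by fact
  have ac: "a \<in> carrier R" using a by (rule P.Icarr)
  interpret A: ideal "PIdl a" R using ac by (rule cgenideal_ideal)
  let ?c = "\<lambda>y. colon R (PIdl a) {y}"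
  have id: "ideal (?c y) R" if "y \<in> carrier R" for y
    using that by (intro ideal_colon A.ideal_axioms) auto
  have mono: "?c y \<subseteq> ?c (z \<otimes> y)" if "y \<in> carrier R" "z \<in> carrier R" for y z
  proof
    fix x assume x: "x \<in> ?c y"
    then have "z \<otimes> (x \<otimes> y) \<in> PIdl a" using that by (auto simp: colon_def intro: A.I_l_closed)
    then show "x \<in> ?c (z \<otimes> y)" using x that by (simp add: colon_def m_lcomm)
  qed
  let ?F = "{?c y | y. y \<in> carrier R \<and> ?c y \<subseteq> P}"
  have "?c \<one> \<subseteq> P"
    using cgenideal_minimal[OF P.ideal_axioms a] by (auto simp: colon_def)
  then have "?F \<noteq> {}" by blast
  then have "\<exists>M\<in>?F. \<forall>I\<in>?F. M \<subseteq> I \<longrightarrow> I = M"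
    by (rule maximal_ideal_of_family) (use id in blast)
  then obtain M where "M \<in> ?F" and *: "\<forall>I\<in>?F. M \<subseteq> I \<longrightarrow> I = M"
    by (rule bexE)
  then obtain y where y: "y \<in> carrier R" "?c y \<subseteq> P" "M = ?c y" by blast
  have max: "?c z = ?c y" if "z \<in> carrier R" "?c z \<subseteq> P" "?c y \<subseteq> ?c z" for z
    using * that y(3) by blast
  have ay: "a \<in> ?c y"
    using ac y cgenideal_self[OF ac] by (auto simp: colon_def intro: A.I_r_closed)
  have nin: "y \<notin> PIdl a"
  proof
    assume "y \<in> PIdl a"
    then have "\<one> \<in> ?c y" using y by (simp add: colon_def)
    then have "\<one> \<in> P" using y by blast
    then show False using P.one_imp_carrier P.I_notcarr by blast
  qed
  have "primeideal (?c y) R"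
  proof (rule primeidealI[OF id[OF y(1)] is_cring])
    have "\<one> \<notin> ?c y" using nin y by (simp add: colon_def)
    then show "carrier R \<noteq> ?c y" by auto
    fix u v assume uv: "u \<in> carrier R" "v \<in> carrier R" "u \<otimes> v \<in> ?c y"
    have uvy: "v \<otimes> (u \<otimes> y) \<in> PIdl a" "u \<otimes> (v \<otimes> y) \<in> PIdl a"
      using uv y by (auto simp: colon_def m_ac)
    show "u \<in> ?c y \<or> v \<in> ?c y"
    \<comment> \<open>In the first case maximality gives \<open>?c (u \<otimes> y) = ?c y\<close>,
      and \<open>v\<close> lies in it. Otherwise some \<open>s\<close> outside \<open>P\<close>
      multiplies \<open>u \<otimes> y\<close> into \<open>PIdl a\<close>; primality of
      \<open>P\<close> puts \<open>?c (s \<otimes> y)\<close> inside \<open>P\<close>, so it equals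
      \<open>?c y\<close>, and it contains \<open>u\<close>.\<close>
    proof (cases "?c (u \<otimes> y) \<subseteq> P")
      case True
      have "?c y \<subseteq> ?c (u \<otimes> y)"
        using uv y by (intro mono)
      then have "?c (u \<otimes> y) = ?c y"
        using max[of "u \<otimes> y"] True uv y by simp
      then show ?thesis using uvy uv by (auto simp: colon_def)
    next
      case False
      then obtain s where s: "s \<in> carrier R" "s \<otimes> (u \<otimes> y) \<in> PIdl a" "s \<notin> P"
        by (auto simp: colon_def)
      have "?c (s \<otimes> y) \<subseteq> P"
      proof
        fix w assume w: "w \<in> ?c (s \<otimes> y)"
        then have wc: "w \<in> carrier R" by (simp add: colon_def)
        have "w \<otimes> s \<in> ?c y" using w s y by (auto simp: colon_def m_ac)
        then show "w \<in> P" using y P.I_prime[of w s] s wc by blast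
      qed
      moreover have "?c y \<subseteq> ?c (s \<otimes> y)"
        using s y by (intro mono)
      ultimately have "?c (s \<otimes> y) = ?c y"
        using max[of "s \<otimes> y"] s y by simp
      moreover have "u \<in> ?c (s \<otimes> y)" using s uv y by (auto simp: colon_def m_ac)
      ultimately show ?thesis by blast
    qed
  qed
  with that y ay nin show ?thesis by blast
qed

section \<open>Linear dependence and integral equations\<close>

lemma (in domain) to_fraction_eq_zero_iff:
  "a \<in> carrier R \<Longrightarrow> to_fraction R a = \<zero>\<^bsub>fraction_field R\<^esub> \<longleftrightarrow> a = \<zero>"
  by (simp add: to_fraction_def fraction_simps)

text \<open>The ideals generated by the first \<open>n\<close> terms increase and hence stabilise.\<close>

lemma (in noetherian_domain) seq_linear_dependence:
  fixes s :: "nat \<Rightarrow> 'a"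
  assumes sc: "\<And>n. s n \<in> carrier R"
  obtains n f where "f \<in> {..<n} \<rightarrow> carrier R" "s n = (\<Oplus>i\<in>{..<n}. f i \<otimes> s i)"
proof -
  define J where "J n = {y \<in> carrier R. \<exists>f. f \<in> {..<n} \<rightarrow> carrier R \<and>
    y = (\<Oplus>i\<in>{..<n}. f i \<otimes> s i)}" for n
  have idJ: "ideal (J n) R" for n
  proof (rule idealI_mult)
    show "J n \<subseteq> carrier R" by (auto simp: J_def)
    show "\<zero> \<in> J n" unfolding J_def
      using sc by (auto intro!: exI[of _ "\<lambda>_. \<zero>"] simp: Pi_def cong: finsum_cong)
  next
    fix x y assume "x \<in> J n" "y \<in> J n"
    then obtain f g where fg: "f \<in> {..<n} \<rightarrow> carrier R" "g \<in> {..<n} \<rightarrow> carrier R"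
      "x = (\<Oplus>i\<in>{..<n}. f i \<otimes> s i)" "y = (\<Oplus>i\<in>{..<n}. g i \<otimes> s i)"
      by (auto simp: J_def)
    have "x \<oplus> y = (\<Oplus>i\<in>{..<n}. f i \<otimes> s i \<oplus> g i \<otimes> s i)"
      using fg sc by (subst finsum_addf) (auto simp: Pi_def)
    also have "\<dots> = (\<Oplus>i\<in>{..<n}. (f i \<oplus> g i) \<otimes> s i)"
      using fg sc by (intro finsum_cong') (auto simp: Pi_def l_distr)
    finally show "x \<oplus> y \<in> J n"
      using fg sc unfolding J_def by (auto intro!: exI[of _ "\<lambda>i. f i \<oplus> g i"] finsum_closed simp: Pi_def)
  next
    fix r x assume r: "r \<in> carrier R" and "x \<in> J n"
    then obtain f where f: "f \<in> {..<n} \<rightarrow> carrier R" "x = (\<Oplus>i\<in>{..<n}. f i \<otimes> s i)"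
      by (auto simp: J_def)
    have "r \<otimes> x = (\<Oplus>i\<in>{..<n}. r \<otimes> (f i \<otimes> s i))"
      unfolding f(2) using f r sc by (intro finsum_rdistr) (auto simp: Pi_def)
    also have "\<dots> = (\<Oplus>i\<in>{..<n}. (r \<otimes> f i) \<otimes> s i)"
      using f r sc by (intro finsum_cong') (auto simp: Pi_def m_assoc)
    finally show "r \<otimes> x \<in> J n"
      using f r sc unfolding J_def by (auto intro!: exI[of _ "\<lambda>i. r \<otimes> f i"] finsum_closed simp: Pi_def)
  qed
  have Jmono: "J n \<subseteq> J (Suc n)" for n
  proof
    fix y assume "y \<in> J n"
    then obtain f where f: "f \<in> {..<n} \<rightarrow> carrier R" "y = (\<Oplus>i\<in>{..<n}. f i \<otimes> s i)" "y \<in> carrier R"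
      by (auto simp: J_def)
    let ?f = "f(n := \<zero>)"
    have "(\<Oplus>i\<in>{..<n}. ?f i \<otimes> s i) = y"
      unfolding f(2) using f sc by (intro finsum_cong') (auto simp: Pi_def)
    then have "(\<Oplus>i\<in>{..<Suc n}. ?f i \<otimes> s i) = y"
      using f sc by (simp add: lessThan_Suc Pi_def)
    then show "y \<in> J (Suc n)"
      using f unfolding J_def by (auto intro!: exI[of _ ?f] simp: Pi_def less_Suc_eq)
  qed
  have sJ: "s n \<in> J (Suc n)" for n
  proof -
    let ?f = "\<lambda>i. if i = n then \<one> else \<zero>"
    have "(\<Oplus>i\<in>{..<n}. ?f i \<otimes> s i) = (\<Oplus>i\<in>{..<n}. \<zero>)"
      using sc by (intro finsum_cong') auto
    then have "(\<Oplus>i\<in>{..<Suc n}. ?f i \<otimes> s i) = s n"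
      using sc by (simp add: lessThan_Suc Pi_def)
    then show ?thesis using sc unfolding J_def by (auto intro!: exI[of _ ?f])
  qed
  have "\<exists>M\<in>range J. \<forall>I\<in>range J. M \<subseteq> I \<longrightarrow> I = M"
    by (rule maximal_ideal_of_family) (use idJ in auto)
  then obtain n where "\<forall>I\<in>range J. J n \<subseteq> I \<longrightarrow> I = J n" by (elim bexE rangeE) simp
  then have "J (Suc n) = J n" using Jmono by simp
  then have "s n \<in> J n" using sJ[of n] by simp
  then obtain f where "f \<in> {..<n} \<rightarrow> carrier R" "s n = (\<Oplus>i\<in>{..<n}. f i \<otimes> s i)"
    unfolding J_def mem_Collect_eq by (elim conjE exE)
  then show ?thesis by (rule that)
qed

text \<open>The relation becomes a monic polynomial with coefficients \<open>\<ominus> f i\<close>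
  below degree \<open>n\<close>; \<open>\<one> \<noteq> \<zero>\<close> makes \<open>\<one>\<close>
  a legitimate leading coefficient.\<close>

lemma (in ring) integral_overI:
  fixes n :: nat
  assumes A: "subring A R" and x: "x \<in> carrier R" and f: "f \<in> {..<n} \<rightarrow> A"
    and eq: "x [^] n = (\<Oplus>i\<in>{..<n}. f i \<otimes> x [^] i)" and nz: "\<one> \<noteq> \<zero>"
  shows "integral_over R A x"
proof -
  note A' = subringE[OF A]
  have fc: "f i \<in> carrier R" "\<ominus> f i \<in> A" if "i < n" for i using f A'(1,5) that by auto
  let ?g = "\<lambda>i. if i < n then \<ominus> f i else \<one>"
  have "(\<Oplus>i\<in>{..<n}. ?g i \<otimes> x [^] i) = (\<Oplus>i\<in>{..<n}. (\<ominus> \<one>) \<otimes> (f i \<otimes> x [^] i))"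
    using fc x by (intro finsum_cong') (auto simp: l_minus)
  also have "\<dots> = (\<ominus> \<one>) \<otimes> x [^] n"
    unfolding eq using fc x by (intro finsum_rdistr[symmetric]) auto
  finally have "(\<Oplus>i\<in>{..<Suc n}. ?g i \<otimes> x [^] i) = \<zero>"
    using fc x by (simp add: lessThan_Suc Pi_def l_minus r_neg)
  then have "eval (map ?g (rev [0..<Suc n])) x = \<zero>"
    using fc x by (subst eval_map_upt) (auto simp: Pi_def)
  moreover have "set (map ?g (rev [0..<Suc n])) \<subseteq> A"
    using fc A'(3) by auto
  ultimately show ?thesis
    unfolding integral_over_def polynomial_def using nz
    by (intro exI[of _ "map ?g (rev [0..<Suc n])"]) auto
qed

section \<open>Ideals of a Dedekind domain\<close>

context dedekind_domain
begin

text \<open>By \<open>stable\<close>, the fraction \<open>b / a\<close> maps \<open>I\<close> into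
  itself. Applying its powers to a nonzero \<open>c\<close> in \<open>I\<close> gives a sequence in
  the ring, one term of which is a combination of the earlier ones; cancelling \<open>c\<close>
  leaves a monic equation for \<open>b / a\<close>. This takes the place of the determinant
  argument.\<close>

lemma stable_imp_mem_PIdl:
  assumes I: "ideal I D" "I \<noteq> {\<zero>}" and a: "a \<in> carrier D" "a \<noteq> \<zero>" and b: "b \<in> carrier D"
    and stable: "\<And>c. c \<in> I \<Longrightarrow> \<exists>d\<in>I. b \<otimes> c = a \<otimes> d"
  shows "b \<in> PIdl a"
proof -
  interpret I: ideal I D by fact
  interpret F: field "fraction_field D" by (rule field_fraction_field)
  interpret h: ring_hom_cring D "fraction_field D" "to_fraction D"
    by (intro ring_hom_cring.intro ring_hom_cring_axioms.intro is_cring F.is_cring to_fraction_hom)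
  obtain c where c: "c \<in> I" "c \<noteq> \<zero>" using I I.zero_closed by blast
  obtain g where g: "\<And>c. c \<in> I \<Longrightarrow> g c \<in> I \<and> b \<otimes> c = a \<otimes> g c"
    using stable by metis
  \<comment> \<open>Since \<open>g\<close> is multiplication by \<open>b / a\<close> on
    \<open>I\<close>, \<open>s n\<close> is \<open>(b / a)^n c\<close>; this is proved as
    \<open>hs\<close> below.\<close>
  define s where "s n = (g ^^ n) c" for n
  have sI: "s n \<in> I" for n by (induction n) (use c g in \<open>auto simp: s_def\<close>)
  then have sc: "s n \<in> carrier D" for n using I.Icarr by blast
  have s_step: "b \<otimes> s n = a \<otimes> s (Suc n)" for n using g[OF sI[of n]] by (simp add: s_def)
  define \<tau> where "\<tau> = fraction D b a"
  let ?K = "fraction_field D" and ?h = "to_fraction D"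
  have tc: "\<tau> \<in> carrier ?K" unfolding \<tau>_def using a b by simp
  have hc: "?h c \<in> carrier ?K" "?h c \<noteq> \<zero>\<^bsub>?K\<^esub>"
    using c I.Icarr by (simp_all add: to_fraction_eq_zero_iff)
  have ha: "?h a \<in> carrier ?K" "?h a \<noteq> \<zero>\<^bsub>?K\<^esub>"
    using a by (simp_all add: to_fraction_eq_zero_iff)
  have ta: "\<tau> \<otimes>\<^bsub>?K\<^esub> ?h a = ?h b"
    unfolding \<tau>_def using a b by (intro fraction_quotient) auto
  have hs: "?h (s n) = \<tau> [^]\<^bsub>?K\<^esub> n \<otimes>\<^bsub>?K\<^esub> ?h c" for n
  proof (induction n)
    case 0
    then show ?case using hc by (simp add: s_def)
  next
    case (Suc n)
    have "?h a \<otimes>\<^bsub>?K\<^esub> ?h (s (Suc n)) = ?h b \<otimes>\<^bsub>?K\<^esub> ?h (s n)"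
      using s_step[of n] sc a b by (metis h.hom_mult)
    also have "\<dots> = ?h a \<otimes>\<^bsub>?K\<^esub> (\<tau> [^]\<^bsub>?K\<^esub> Suc n \<otimes>\<^bsub>?K\<^esub> ?h c)"
      using Suc ta tc ha hc by (simp add: ta[symmetric] F.m_ac)
    finally show ?case
      using ha hc tc sc F.m_lcancel[of "?h a"] by simp
  qed
  let ?A = "?h ` carrier D"
  obtain n f where f: "f \<in> {..<n} \<rightarrow> carrier D" "s n = (\<Oplus>i\<in>{..<n}. f i \<otimes> s i)"
    using sc by (rule seq_linear_dependence)
  have "\<tau> [^]\<^bsub>?K\<^esub> n \<otimes>\<^bsub>?K\<^esub> ?h c = (\<Oplus>\<^bsub>?K\<^esub>i\<in>{..<n}. ?h (f i \<otimes> s i))"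
    unfolding hs[symmetric] f(2) using f sc by (subst h.hom_finsum) (simp_all add: Pi_iff comp_def)
  also have "\<dots> = (\<Oplus>\<^bsub>?K\<^esub>i\<in>{..<n}. (?h (f i) \<otimes>\<^bsub>?K\<^esub> \<tau> [^]\<^bsub>?K\<^esub> i) \<otimes>\<^bsub>?K\<^esub> ?h c)"
    using f sc tc hc by (intro F.finsum_cong') (simp_all add: Pi_iff hs F.m_assoc)
  also have "\<dots> = (\<Oplus>\<^bsub>?K\<^esub>i\<in>{..<n}. ?h (f i) \<otimes>\<^bsub>?K\<^esub> \<tau> [^]\<^bsub>?K\<^esub> i) \<otimes>\<^bsub>?K\<^esub> ?h c"
    using f hc tc by (intro F.finsum_ldistr[symmetric]) (simp_all add: Pi_iff)
  finally have "\<tau> [^]\<^bsub>?K\<^esub> n = (\<Oplus>\<^bsub>?K\<^esub>i\<in>{..<n}. ?h (f i) \<otimes>\<^bsub>?K\<^esub> \<tau> [^]\<^bsub>?K\<^esub> i)"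
    using f hc tc F.m_rcancel[of "?h c"] by (simp add: Pi_iff F.finsum_closed)
  moreover have "subring ?A ?K"
    by (rule ring_hom_ring.img_is_subring[OF ring_hom_ringI2[OF ring_axioms F.ring_axioms
      to_fraction_hom] carrier_is_subring])
  moreover have "(\<lambda>i. ?h (f i)) \<in> {..<n} \<rightarrow> ?A" using f by blast
  ultimately have "integral_over ?K ?A \<tau>"
    using tc by (intro F.integral_overI[where n = n and f = "\<lambda>i. ?h (f i)"]) simp_all
  then obtain d where d: "d \<in> carrier D" "\<tau> = ?h d"
    using integrally_closed tc unfolding integrally_closed_def by blast
  then have "?h (d \<otimes> a) = ?h b" using ta a by simp
  then have "b = d \<otimes> a" using d a b inj_onD[OF inj_on_to_fraction] m_closed by metis
  then show ?thesis using d unfolding cgenideal_def by blast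
qed

lemma mem_PIdl_iff: "a \<in> carrier D \<Longrightarrow> x \<in> PIdl a \<longleftrightarrow> (\<exists>d\<in>carrier D. x = a \<otimes> d)"
  using m_comm by (fastforce simp: cgenideal_def)

text \<open>In terms of fractions: \<open>P P\<inverse> = D\<close>, where \<open>P\<inverse>\<close> consists of the \<open>b / a\<close>
  with \<open>b P \<subseteq> a D\<close>, and \<open>P\<inverse> \<noteq> D\<close>.\<close>

lemma maximalideal_invertible:
  assumes P: "maximalideal P D" "P \<noteq> {\<zero>}"
  obtains a y where "a \<in> P" "a \<noteq> \<zero>" "y \<in> colon D (PIdl a) P" "y \<notin> PIdl a"
    "\<And>I. \<lbrakk>ideal I D; \<And>p b. \<lbrakk>p \<in> P; b \<in> colon D (PIdl a) P\<rbrakk> \<Longrightarrow> p \<otimes> b \<in> I\<rbrakk> \<Longrightarrow> a \<in> I"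
proof -
  interpret P: maximalideal P D by fact
  have "primeideal P D" using P(1) by (rule maximalideal_prime)
  obtain a where a: "a \<in> P" "a \<noteq> \<zero>" using P(2) P.zero_closed by blast
  have ac: "a \<in> carrier D" using a P.Icarr by blast
  obtain y where y: "y \<in> carrier D" "y \<notin> PIdl a" "primeideal (colon D (PIdl a) {y}) D"
    "a \<in> colon D (PIdl a) {y}" "colon D (PIdl a) {y} \<subseteq> P"
    using \<open>primeideal P D\<close> a(1) by (rule exists_prime_colon)
  have "maximalideal (colon D (PIdl a) {y}) D"
    using y(3,4) a(2) by (intro nonzero_prime_maximal) auto
  then have "colon D (PIdl a) {y} = P"
    using maximalideal.I_maximal[OF _ P.ideal_axioms y(5)] P.I_notcarr P.a_subset by blast
  then have "y \<otimes> s \<in> PIdl a" if "s \<in> P" for s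
    using that m_comm[OF y(1)] by (auto simp: colon_def)
  then have yQ: "y \<in> colon D (PIdl a) P"
    using y(1) by (simp add: colon_def)
  have "a \<in> I" if I: "ideal I D" and prod: "\<And>p b. \<lbrakk>p \<in> P; b \<in> colon D (PIdl a) P\<rbrakk> \<Longrightarrow> p \<otimes> b \<in> I" for I
  proof -
    \<comment> \<open>As \<open>a\<close> itself lies in \<open>colon D (PIdl a) P\<close>, this
      ideal contains \<open>P\<close>, so it is \<open>P\<close> or the whole ring. In the latter
      case \<open>a\<close> lies in \<open>I\<close>.\<close>
    let ?J = "colon D I {a}"
    have "a \<in> colon D (PIdl a) P"
      using ac P.Icarr by (auto simp: colon_def mem_PIdl_iff)
    then have "P \<subseteq> ?J" using prod P.Icarr by (auto simp: colon_def)
    moreover have J: "ideal ?J D" using I ac by (intro ideal_colon) auto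
    ultimately have "?J = P \<or> ?J = carrier D"
      using P.I_maximal[of ?J] by (auto simp: colon_def)
    \<comment> \<open>If \<open>?J\<close> were \<open>P\<close>, each \<open>y \<otimes> p\<close>
      would be \<open>a \<otimes> d\<close> with \<open>d\<close> in \<open>P\<close>. So
      \<open>y / a\<close> would map \<open>P\<close> into itself and lie in the ring, contrary to
      the choice of \<open>y\<close>.\<close>
    moreover have "?J \<noteq> P"
    proof
      assume eq: "?J = P"
      have "\<exists>d\<in>P. y \<otimes> p = a \<otimes> d" if p: "p \<in> P" for p
      proof -
        obtain d where d: "d \<in> carrier D" "y \<otimes> p = a \<otimes> d"
          using yQ p ac by (auto simp: colon_def mem_PIdl_iff)
        moreover have "y \<otimes> p \<in> I" using prod[OF p yQ] y(1) p P.Icarr m_comm by metis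
        ultimately have "d \<in> ?J" using ac by (simp add: colon_def m_comm)
        then show ?thesis using d eq by blast
      qed
      then have "y \<in> PIdl a" using P.ideal_axioms P(2) ac a(2) y(1) by (intro stable_imp_mem_PIdl)
      then show False using y(2) by simp
    qed
    ultimately have "\<one> \<in> ?J" by simp
    then show ?thesis using ac by (simp add: colon_def)
  qed
  with that a yQ y(2) show ?thesis by blast
qed

text \<open>With \<open>b / a\<close> in the inverse of \<open>P\<close>, this says that the inverse
  of \<open>P\<close> times \<open>I\<close> lies in \<open>I : P\<close>. For \<open>q\<close> in
  \<open>P\<close>, \<open>t q\<close> equals \<open>(b q / a) c\<close>, and \<open>b q / a\<close>
  is a ring element.\<close>

lemma quotient_mem_colon:
  assumes I: "ideal I D" and P: "P \<subseteq> carrier D" and a: "a \<in> carrier D" "a \<noteq> \<zero>"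
    and b: "b \<in> colon D (PIdl a) P" and c: "c \<in> I" and t: "t \<in> carrier D" "b \<otimes> c = a \<otimes> t"
  shows "t \<in> colon D I P"
proof -
  have cc: "c \<in> carrier D" using I c by (rule ideal.Icarr)
  have "t \<otimes> q \<in> I" if q: "q \<in> P" for q
  proof -
    have bq: "b \<in> carrier D" "q \<in> carrier D" using b q P by (auto simp: colon_def)
    obtain u where u: "u \<in> carrier D" "b \<otimes> q = a \<otimes> u"
      using b q a(1) by (auto simp: colon_def mem_PIdl_iff)
    have "a \<otimes> (t \<otimes> q) = (b \<otimes> c) \<otimes> q" using t a bq by (simp add: m_assoc)
    also have "\<dots> = (b \<otimes> q) \<otimes> c" using bq cc by (simp add: m_ac)
    also have "\<dots> = a \<otimes> (u \<otimes> c)" using u a cc by (simp add: m_assoc)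
    finally have "t \<otimes> q = u \<otimes> c" using m_lcancel[of a "t \<otimes> q" "u \<otimes> c"] a t bq u cc by simp
    then show ?thesis using ideal.I_l_closed[OF I c u(1)] by simp
  qed
  then show ?thesis using t by (simp add: colon_def)
qed

text \<open>Since \<open>P\<close> is invertible, \<open>I\<close> can be recovered from
  \<open>I : P\<close>. Used in both directions, this makes the passage to \<open>I : P\<close>
  injective on the ideals inside \<open>P\<close>.\<close>

lemma colon_maximalideal_subset:
  assumes P: "maximalideal P D" "P \<noteq> {\<zero>}" and I: "ideal I D" "I \<subseteq> P" and I': "ideal I' D"
    and sub: "colon D I P \<subseteq> colon D I' P"
  shows "I \<subseteq> I'"
proof
  fix c assume c: "c \<in> I"
  interpret P: maximalideal P D by fact
  interpret I': ideal I' D by fact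
  obtain a where a: "a \<in> P" "a \<noteq> \<zero>"
    and inv: "\<And>I. \<lbrakk>ideal I D; \<And>p b. \<lbrakk>p \<in> P; b \<in> colon D (PIdl a) P\<rbrakk> \<Longrightarrow> p \<otimes> b \<in> I\<rbrakk> \<Longrightarrow> a \<in> I"
    using maximalideal_invertible[OF P] by metis
  have ac: "a \<in> carrier D" and cc: "c \<in> carrier D" using a c I P.Icarr by blast+
  \<comment> \<open>These are the \<open>d\<close> for which \<open>(d / a) c\<close> lies in
    \<open>I'\<close>. All products \<open>p \<otimes> b\<close> are among them, so invertibility
    gives \<open>a \<in> ?K\<close>, that is, \<open>c \<in> I'\<close>.\<close>
  let ?K = "{d \<in> carrier D. \<exists>i\<in>I'. d \<otimes> c = a \<otimes> i}"
  have "ideal ?K D"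
  proof (rule idealI_mult)
    show "\<zero> \<in> ?K" using ac cc I'.zero_closed by (auto intro!: bexI[of _ \<zero>])
    show "x \<oplus> y \<in> ?K" if "x \<in> ?K" "y \<in> ?K" for x y
    proof -
      obtain i j where ij: "i \<in> I'" "j \<in> I'" "x \<otimes> c = a \<otimes> i" "y \<otimes> c = a \<otimes> j"
        and xy: "x \<in> carrier D" "y \<in> carrier D" using \<open>x \<in> ?K\<close> \<open>y \<in> ?K\<close> by blast
      then have "(x \<oplus> y) \<otimes> c = a \<otimes> (i \<oplus> j)" using ac cc I'.Icarr by (simp add: l_distr r_distr)
      then show ?thesis using xy ij I'.a_closed by blast
    qed
    show "r \<otimes> x \<in> ?K" if r: "r \<in> carrier D" and "x \<in> ?K" for r x
    proof -
      obtain i where i: "i \<in> I'" "x \<otimes> c = a \<otimes> i" "x \<in> carrier D" using \<open>x \<in> ?K\<close> by blast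
      then have "(r \<otimes> x) \<otimes> c = a \<otimes> (r \<otimes> i)"
        using r ac cc I'.Icarr by (simp add: m_assoc) (simp add: m_lcomm)
      then show ?thesis using i r I'.I_l_closed by blast
    qed
  qed simp
  moreover have "p \<otimes> b \<in> ?K" if p: "p \<in> P" and b: "b \<in> colon D (PIdl a) P" for p b
  proof -
    have bc: "b \<in> carrier D" "p \<in> carrier D" using b p P.Icarr by (auto simp: colon_def)
    obtain t where t: "t \<in> carrier D" "b \<otimes> c = a \<otimes> t"
      using b c I(2) ac by (auto simp: colon_def mem_PIdl_iff)
    then have "t \<in> colon D I' P"
      using quotient_mem_colon[OF I(1) P.a_subset ac a(2) b c t] sub by blast
    then have "t \<otimes> p \<in> I'" using p by (simp add: colon_def)
    moreover have "(p \<otimes> b) \<otimes> c = a \<otimes> (t \<otimes> p)"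
      using t bc cc ac by (simp add: m_assoc) (simp add: m_ac)
    ultimately show ?thesis using bc by blast
  qed
  ultimately have "a \<in> ?K" by (rule inv)
  then obtain i where i: "i \<in> I'" "a \<otimes> c = a \<otimes> i" by blast
  then have "c = i" using m_lcancel[of a c i] a ac cc I'.Icarr by simp
  then show "c \<in> I'" using i by simp
qed

text \<open>Were the two ideals equal, a fraction \<open>y / a\<close> outside the ring that carries
  \<open>P\<close> into the ring would carry \<open>I\<close> into itself, hence lie in the
  ring.\<close>

lemma psubset_colon_maximalideal:
  assumes P: "maximalideal P D" "P \<noteq> {\<zero>}" and I: "ideal I D" "I \<subseteq> P" "I \<noteq> {\<zero>}"
  shows "I \<subset> colon D I P"
proof -
  interpret P: maximalideal P D by fact
  obtain a y where a: "a \<in> P" "a \<noteq> \<zero>" and y: "y \<in> colon D (PIdl a) P" "y \<notin> PIdl a"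
    using maximalideal_invertible[OF P] by metis
  have ac: "a \<in> carrier D" and yc: "y \<in> carrier D" using a P.Icarr y by (auto simp: colon_def)
  have "I \<noteq> colon D I P"
  proof
    assume eq: "I = colon D I P"
    have "\<exists>t\<in>I. y \<otimes> c = a \<otimes> t" if c: "c \<in> I" for c
    proof -
      obtain t where t: "t \<in> carrier D" "y \<otimes> c = a \<otimes> t"
        using y(1) c I(2) ac by (auto simp: colon_def mem_PIdl_iff)
      then have "t \<in> colon D I P"
        using quotient_mem_colon[OF I(1) P.a_subset ac a(2) y(1) c t] by blast
      then show ?thesis using t eq by auto
    qed
    then have "y \<in> PIdl a" using I ac a(2) yc by (intro stable_imp_mem_PIdl)
    then show False using y(2) by simp
  qed
  then show ?thesis using subset_colon[OF I(1) P.a_subset] by blast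
qed

section \<open>Counting ideals and units\<close>

theorem countable_ideals:
  assumes "countable {M. maximalideal M D}"
  shows "countable {I. ideal I D}"
proof -
  \<comment> \<open>\<open>F n\<close> holds the ideals that reach the whole ring in
    \<open>n\<close> steps \<open>I \<mapsto> I : P\<close>, that is, the products of
    \<open>n\<close> nonzero maximal ideals.\<close>
  define F where "F = rec_nat {carrier D} (\<lambda>_ Y. {I. ideal I D \<and>
    (\<exists>P. maximalideal P D \<and> P \<noteq> {\<zero>} \<and> I \<subseteq> P \<and> colon D I P \<in> Y)})"
  have F0: "F 0 = {carrier D}" by (simp add: F_def)
  have FS: "F (Suc n) = {I. ideal I D \<and>
    (\<exists>P. maximalideal P D \<and> P \<noteq> {\<zero>} \<and> I \<subseteq> P \<and> colon D I P \<in> F n)}" for n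
    by (simp add: F_def)
  have "countable (F n)" for n
  proof (induction n)
    case 0
    then show ?case by (simp add: F0)
  next
    case (Suc n)
    let ?G = "\<lambda>P. {I. ideal I D \<and> P \<noteq> {\<zero>} \<and> I \<subseteq> P \<and> colon D I P \<in> F n}"
    have "countable (?G P)" if "maximalideal P D" for P
    proof (rule countable_image_inj_on)
      show "countable ((\<lambda>I. colon D I P) ` ?G P)"
        by (rule countable_subset[OF _ Suc]) blast
      show "inj_on (\<lambda>I. colon D I P) (?G P)"
        using that by (intro inj_onI equalityI) (auto dest: colon_maximalideal_subset)
    qed
    then have "countable (\<Union>P\<in>{M. maximalideal M D}. ?G P)"
      using assms by (intro countable_UN) auto
    moreover have "F (Suc n) \<subseteq> (\<Union>P\<in>{M. maximalideal M D}. ?G P)"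
      unfolding FS by blast
    ultimately show ?case by (rule countable_subset[rotated])
  qed
  then have "countable (insert {\<zero>} (\<Union>n. F n))" by simp
  moreover have "{I. ideal I D} \<subseteq> insert {\<zero>} (\<Union>n. F n)"
  proof (rule ccontr)
    assume notF: "\<not> {I. ideal I D} \<subseteq> insert {\<zero>} (\<Union>n. F n)"
    \<comment> \<open>Noetherian induction: for a maximal member \<open>M\<close>, the colon by a
      maximal ideal above \<open>M\<close> is strictly larger, hence lies in some
      \<open>F n\<close>, and so \<open>M\<close> lies in \<open>F (Suc n)\<close>.\<close>
    let ?B = "{I. ideal I D \<and> I \<noteq> {\<zero>} \<and> (\<forall>n. I \<notin> F n)}"
    have "\<exists>M\<in>?B. \<forall>I\<in>?B. M \<subseteq> I \<longrightarrow> I = M"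
      using notF by (intro maximal_ideal_of_family) blast+
    then obtain M where MB: "M \<in> ?B" and max: "\<forall>I\<in>?B. M \<subseteq> I \<longrightarrow> I = M" by (rule bexE)
    have M: "ideal M D" "M \<noteq> {\<zero>}" "\<And>n. M \<notin> F n" using MB by auto
    have "M \<noteq> carrier D" using M(3)[of 0] by (simp add: F0)
    then obtain P where P: "maximalideal P D" "M \<subseteq> P" using M by (metis exists_maximalideal)
    have nz: "\<zero> \<in> M" using M(1) by (rule ideal_memE)
    then have "P \<noteq> {\<zero>}" using P M by blast
    then have lt: "M \<subset> colon D M P" using psubset_colon_maximalideal P M by simp
    have "P \<subseteq> carrier D" using ideal.Icarr[OF maximalideal.axioms(1)[OF P(1)]] by blast
    then have "ideal (colon D M P) D" using M(1) by (intro ideal_colon)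
    moreover have "colon D M P \<noteq> {\<zero>}" using lt nz by auto
    moreover have "colon D M P \<notin> ?B"
    proof
      assume "colon D M P \<in> ?B"
      then have "M \<subseteq> colon D M P \<longrightarrow> colon D M P = M" by (rule bspec[OF max])
      then show False using lt by (metis psubsetE order.refl)
    qed
    ultimately obtain n where "colon D M P \<in> F n" by auto
    then have "M \<in> F (Suc n)" unfolding FS using M(1) \<open>P \<noteq> {\<zero>}\<close> P by blast
    then show False using M(3) by simp
  qed
  ultimately show ?thesis by (rule countable_subset[rotated])
qed

theorem uncountable_Units:
  assumes "uncountable (carrier D)" "countable {M. maximalideal M D}"
  shows "uncountable (Units D)"
proof
  assume U: "countable (Units D)"
  \<comment> \<open>A fibre of \<open>b \<mapsto> PIdl b\<close> is empty or consists of the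
    associates of one element, hence is covered by an image of the units.\<close>
  have fin: "countable {b \<in> carrier D. PIdl b = J}" for J
  proof (cases "\<exists>a\<in>carrier D. PIdl a = J")
    case True
    then obtain a where a: "a \<in> carrier D" "PIdl a = J" by blast
    have "{b \<in> carrier D. PIdl b = J} \<subseteq> (\<lambda>u. u \<otimes> a) ` Units D"
    proof
      fix b assume "b \<in> {b \<in> carrier D. PIdl b = J}"
      then have b: "b \<in> carrier D" "PIdl b = J" by simp_all
      then have "b \<sim> a" using a associated_iff_same_ideal by simp
      then show "b \<in> (\<lambda>u. u \<otimes> a) ` Units D" using ring_associated_iff[of b a] a b by blast
    qed
    then show ?thesis by (rule countable_subset) (rule countable_image[OF U])
  next
    case False
    then have "{b \<in> carrier D. PIdl b = J} = {}" by blast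
    then show ?thesis by (simp only: countable_empty)
  qed
  have "countable (\<Union>J\<in>{I. ideal I D}. {b \<in> carrier D. PIdl b = J})"
    using countable_ideals[OF assms(2)] fin by (rule countable_UN)
  moreover have "carrier D \<subseteq> (\<Union>J\<in>{I. ideal I D}. {b \<in> carrier D. PIdl b = J})"
    by (auto intro: cgenideal_ideal)
  ultimately have "countable (carrier D)" by (rule countable_subset[rotated])
  then show False using assms(1) by simp
qed

end

section \<open>Subrings maximal with a given property\<close>

lemma (in ring) subring_Union_chain:
  assumes "C \<noteq> {}" "subset.chain {B. subring B R \<and> Q B} C"
  shows "subring (\<Union>C) R"
proof -
  have sub: "subring B R" if "B \<in> C" for B using assms(2) that by (auto simp: pred_on.chain_def)
  \<comment> \<open>Any two elements of the union lie in a common member of the chain; this settles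
    the binary operations.\<close>
  have two: "\<exists>B\<in>C. x \<in> B \<and> y \<in> B" if "x \<in> \<Union>C" "y \<in> \<Union>C" for x y
    using finite_subset_Union_chain[OF _ _ assms, of "{x, y}"] that
    by (metis finite.intros insert_subset empty_subsetI)
  show ?thesis
  proof (rule subringI)
    show "\<Union>C \<subseteq> carrier R" using subringE(1)[OF sub] by (rule Union_least)
    show "\<one> \<in> \<Union>C" using subringE(3)[OF sub] assms(1) by auto
    show "\<ominus> h \<in> \<Union>C" if "h \<in> \<Union>C" for h using that subringE(5)[OF sub] by auto
    show "h1 \<otimes> h2 \<in> \<Union>C" if "h1 \<in> \<Union>C" "h2 \<in> \<Union>C" for h1 h2
      using two[OF that] subringE(6)[OF sub] by (auto intro: UnionI)
    show "h1 \<oplus> h2 \<in> \<Union>C" if "h1 \<in> \<Union>C" "h2 \<in> \<Union>C" for h1 h2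
      using two[OF that] subringE(7)[OF sub] by (auto intro: UnionI)
  qed
qed

lemma (in ring) exists_maximal_subring_with:
  assumes A: "subring A R" "Q A"
    and chain: "\<And>C. \<lbrakk>C \<noteq> {}; subset.chain {B. subring B R \<and> A \<subseteq> B \<and> Q B} C\<rbrakk> \<Longrightarrow> Q (\<Union>C)"
  obtains M where "subring M R" "A \<subseteq> M" "Q M"
    "\<And>B. \<lbrakk>subring B R; M \<subseteq> B; Q B\<rbrakk> \<Longrightarrow> B = M"
proof -
  let ?F = "{B. subring B R \<and> A \<subseteq> B \<and> Q B}"
  have "\<exists>M\<in>?F. \<forall>B\<in>?F. M \<subseteq> B \<longrightarrow> B = M"
  proof (rule subset_Zorn_nonempty)
    show "?F \<noteq> {}" using A by blast
    fix C assume C: "C \<noteq> {}" "subset.chain ?F C"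
    obtain B where "B \<in> C" using C(1) by blast
    then have "A \<subseteq> \<Union>C" using C(2) by (auto simp: pred_on.chain_def)
    then show "\<Union>C \<in> ?F" using chain[OF C] subring_Union_chain[OF C] by simp
  qed
  then obtain M where M: "M \<in> ?F" "\<forall>B\<in>?F. M \<subseteq> B \<longrightarrow> B = M" by (rule bexE)
  have "B = M" if "subring B R" "M \<subseteq> B" "Q B" for B
    using M that by (metis (mono_tags, lifting) mem_Collect_eq subset_trans)
  then show ?thesis using M(1) that by blast
qed

text \<open>Used twice: in the field of fractions to build \<open>V\<close>, and in the domain
  itself, where it yields the maximal subring.\<close>

lemma (in ring) exists_maximal_subring_avoiding:
  assumes "subring A R" "u \<notin> A"
  obtains M where "subring M R" "A \<subseteq> M" "u \<notin> M"
    "\<And>B. \<lbrakk>subring B R; M \<subseteq> B; u \<notin> B\<rbrakk> \<Longrightarrow> B = M"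
  using assms
proof (rule exists_maximal_subring_with)
  show "u \<notin> \<Union>C" if "subset.chain {B. subring B R \<and> A \<subseteq> B \<and> u \<notin> B} C" for C
    using that by (auto simp: pred_on.chain_def)
qed (use that in blast)

section \<open>Algebraic independence of an element\<close>

text \<open>This is transcendence of \<open>x\<close> over \<open>A\<close>. With coefficient
  functions in place of lists, relations can be multiplied termwise and double sums
  interchanged.\<close>

definition (in ring) alg_indep :: "'a set \<Rightarrow> 'a \<Rightarrow> bool"
  where "alg_indep A x \<longleftrightarrow> (\<forall>n f. f \<in> {..n::nat} \<rightarrow> A \<longrightarrow>
    (\<Oplus>i\<in>{..n}. f i \<otimes> x [^] i) = \<zero> \<longrightarrow> (\<forall>i\<le>n. f i = \<zero>))"

lemma (in ring) alg_indepD: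
  "\<lbrakk>alg_indep A x; f \<in> {..n::nat} \<rightarrow> A; (\<Oplus>i\<in>{..n}. f i \<otimes> x [^] i) = \<zero>; i \<le> n\<rbrakk> \<Longrightarrow> f i = \<zero>"
  unfolding alg_indep_def by blast

text \<open>A relation has finitely many coefficients, so they all lie in one member of the
  chain.\<close>

lemma (in ring) alg_indep_Union_chain:
  assumes C: "C \<noteq> {}" "subset.chain {B. subring B R \<and> A \<subseteq> B \<and> alg_indep B x} C"
  shows "alg_indep (\<Union>C) x"
  unfolding alg_indep_def
proof (intro allI impI)
  fix n :: nat and f i
  assume f: "f \<in> {..n} \<rightarrow> \<Union>C" "(\<Oplus>i\<in>{..n}. f i \<otimes> x [^] i) = \<zero>" "i \<le> n"
  have "f ` {..n} \<subseteq> \<Union>C" using f(1) by blast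
  then obtain B where B: "B \<in> C" "f ` {..n} \<subseteq> B"
    using finite_subset_Union_chain[OF _ _ C, of "f ` {..n}"] by blast
  then have "alg_indep B x" "f \<in> {..n} \<rightarrow> B" using C by (auto simp: pred_on.chain_def)
  then show "f i = \<zero>" using f unfolding alg_indep_def by blast
qed

text \<open>Vanishing top coefficients are dropped, as later steps need a nonzero leading
  one.\<close>

lemma (in ring) relation_leading:
  assumes "f \<in> {..n::nat} \<rightarrow> carrier R" "x \<in> carrier R"
    and "(\<Oplus>i\<in>{..n}. f i \<otimes> x [^] i) = \<zero>" "\<exists>i\<le>n. f i \<noteq> \<zero>"
  shows "\<exists>m\<le>n. f m \<noteq> \<zero> \<and> (\<Oplus>i\<in>{..m}. f i \<otimes> x [^] i) = \<zero>"
  using assms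
proof (induction n)
  case 0
  then show ?case by auto
next
  case (Suc n)
  show ?case
  proof (cases "f (Suc n) = \<zero>")
    case True
    have "(\<Oplus>i\<in>{..n}. f i \<otimes> x [^] i) = \<zero>"
      using Suc.prems(1-3) True by (subst (asm) finsum_Suc) (auto simp: Pi_def)
    moreover have "\<exists>i\<le>n. f i \<noteq> \<zero>" using Suc.prems(4) True le_Suc_eq by metis
    moreover have "f \<in> {..n} \<rightarrow> carrier R" using Suc.prems(1) by auto
    ultimately have "\<exists>m\<le>n. f m \<noteq> \<zero> \<and> (\<Oplus>i\<in>{..m}. f i \<otimes> x [^] i) = \<zero>"
      using Suc.IH Suc.prems(2) by simp
    then show ?thesis using le_SucI by blast
  next
    case False
    then show ?thesis using Suc.prems by blast
  qed
qed

text \<open>Elements of \<open>simple_extension\<close> arise by Horner steps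
  \<open>k1 \<otimes> x \<oplus> k2\<close>, each of which shifts the coefficients by one. The
  expression is given for every large \<open>m\<close>, so that several elements can share one
  degree.\<close>

lemma (in ring) simple_extension_finsum:
  assumes A: "subring A R" and x: "x \<in> carrier R" and y: "y \<in> simple_extension A x"
  obtains n f where "range f \<subseteq> A" "\<And>m. m \<ge> n \<Longrightarrow> y = (\<Oplus>i\<in>{..m::nat}. f i \<otimes> x [^] i)"
proof -
  note Ac = subringE(1)[OF A]
  have "\<exists>n f. range f \<subseteq> A \<and> (\<forall>i>n. f i = \<zero>) \<and> y = (\<Oplus>i\<in>{..n::nat}. f i \<otimes> x [^] i)"
    using y
  proof induction
    case zero
    show ?case
      by (rule exI[of _ 0], rule exI[of _ "\<lambda>_. \<zero>"]) (use subringE(2)[OF A] x in auto)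
  next
    case (lin k1 k2)
    then obtain n f where f: "range f \<subseteq> A" "\<forall>i>n. f i = \<zero>" "k1 = (\<Oplus>i\<in>{..n::nat}. f i \<otimes> x [^] i)"
      by blast
    have fc: "f i \<in> carrier R" for i using f(1) Ac by blast
    have k2: "k2 \<in> carrier R" using lin(2) Ac by blast
    let ?g = "\<lambda>i. case i of 0 \<Rightarrow> k2 | Suc j \<Rightarrow> f j"
    have "(\<Oplus>i\<in>{..Suc n}. ?g i \<otimes> x [^] i) = (\<Oplus>i\<in>{..n}. f i \<otimes> x [^] Suc i) \<oplus> k2"
      using fc k2 x by (subst finsum_Suc2) (auto simp: Pi_def split: nat.split)
    also have "(\<Oplus>i\<in>{..n}. f i \<otimes> x [^] Suc i) = (\<Oplus>i\<in>{..n}. (f i \<otimes> x [^] i) \<otimes> x)"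
      using fc x by (intro finsum_cong') (auto simp: m_assoc)
    also have "\<dots> = k1 \<otimes> x"
      unfolding f(3) using fc x by (intro finsum_ldistr[symmetric]) auto
    finally have "k1 \<otimes> x \<oplus> k2 = (\<Oplus>i\<in>{..Suc n}. ?g i \<otimes> x [^] i)" by simp
    moreover have "range ?g \<subseteq> A" using f(1) lin(2) by (auto simp: image_subset_iff split: nat.split)
    moreover have "\<forall>i>Suc n. ?g i = \<zero>" using f(2) by (auto split: nat.splits)
    ultimately show ?case by blast
  qed
  then obtain n f where f: "range f \<subseteq> A" "\<forall>i>n. f i = \<zero>" "y = (\<Oplus>i\<in>{..n::nat}. f i \<otimes> x [^] i)"
    by blast
  have fc: "f i \<in> carrier R" for i using f(1) Ac by blast
  have "y = (\<Oplus>i\<in>{..m}. f i \<otimes> x [^] i)" if "m \<ge> n" for m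
    using that
  proof (induction m rule: dec_induct)
    case base
    then show ?case by (rule f(3))
  next
    case (step m)
    then show ?case using f(2) fc x by (subst finsum_Suc) (auto simp: Pi_def)
  qed
  then show ?thesis using f(1) that by blast
qed

lemma (in ring) finsum_mem_simple_extension:
  assumes A: "subring A R" and x: "x \<in> carrier R" and f: "f \<in> {..n::nat} \<rightarrow> A"
  shows "(\<Oplus>i\<in>{..n}. f i \<otimes> x [^] i) \<in> simple_extension A x"
  using f
proof (induction n arbitrary: f)
  case 0
  then have "f 0 \<in> A" "f 0 \<in> carrier R" using subringE(1)[OF A] by auto
  then show ?case using simple_extension_incl[OF subringE(1)[OF A] x] by (auto simp: Pi_def)
next
  case (Suc n)
  have fc: "f i \<in> carrier R" if "i \<le> Suc n" for i using Suc.prems subringE(1)[OF A] that by auto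
  have "(\<Oplus>i\<in>{..Suc n}. f i \<otimes> x [^] i) = (\<Oplus>i\<in>{..n}. f (Suc i) \<otimes> x [^] Suc i) \<oplus> f 0"
    using fc x by (subst finsum_Suc2) (auto simp: Pi_def)
  also have "(\<Oplus>i\<in>{..n}. f (Suc i) \<otimes> x [^] Suc i) = (\<Oplus>i\<in>{..n}. (f (Suc i) \<otimes> x [^] i) \<otimes> x)"
    using fc x by (intro finsum_cong') (auto simp: m_assoc)
  also have "\<dots> = (\<Oplus>i\<in>{..n}. f (Suc i) \<otimes> x [^] i) \<otimes> x"
    using fc x by (intro finsum_ldistr[symmetric]) auto
  finally have eq: "(\<Oplus>i\<in>{..Suc n}. f i \<otimes> x [^] i) = (\<Oplus>i\<in>{..n}. f (Suc i) \<otimes> x [^] i) \<otimes> x \<oplus> f 0" .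
  have "(\<Oplus>i\<in>{..n}. f (Suc i) \<otimes> x [^] i) \<in> simple_extension A x"
    using Suc.prems by (intro Suc.IH) auto
  then show ?case unfolding eq using Suc.prems by (intro simple_extension.lin) auto
qed

lemma (in ring) subring_nat_pow:
  assumes "subring A R" "x \<in> A" shows "x [^] (n::nat) \<in> A"
  using assms subringE(3,6)[OF assms(1)] by (induction n) auto

lemma (in domain) simple_extension_subset:
  assumes "subring A R" "x \<in> carrier R"
  shows "subring (simple_extension A x) R" "A \<subseteq> simple_extension A x" "x \<in> simple_extension A x"
  using simple_extension_is_subring[OF assms] simple_extension_mem[OF assms]
    simple_extension_incl[OF subringE(1)[OF assms(1)] assms(2)] by blast+

text \<open>There are countably many coefficient lists over \<open>A\<close>, and a nonzero
  polynomial over a domain has finitely many roots.\<close>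

lemma (in domain) countable_algebraic:
  assumes A: "subring A R" "countable A"
  shows "countable {x \<in> carrier R. \<not> alg_indep A x}"
proof -
  let ?P = "{p \<in> lists A. p \<in> carrier (poly_ring R)}"
  have "countable (\<Union>p\<in>?P. {x. is_root p x})"
  proof (rule countable_UN)
    show "countable ?P" using countable_lists[OF A(2)] by (rule countable_subset[rotated]) blast
    show "countable {x. is_root p x}" if "p \<in> ?P" for p
      using that finite_number_of_roots by (intro countable_finite) simp
  qed
  moreover have "{x \<in> carrier R. \<not> alg_indep A x} \<subseteq> (\<Union>p\<in>?P. {x. is_root p x})"
  proof
    fix x assume "x \<in> {x \<in> carrier R. \<not> alg_indep A x}"
    then obtain n f where x: "x \<in> carrier R" and f: "f \<in> {..n::nat} \<rightarrow> A"
      "(\<Oplus>i\<in>{..n}. f i \<otimes> x [^] i) = \<zero>" "\<exists>i\<le>n. f i \<noteq> \<zero>"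
      unfolding alg_indep_def by blast
    have fc: "f i \<in> carrier R" if "i \<le> n" for i using f(1) subringE(1)[OF A(1)] that by auto
    have "\<exists>m\<le>n. f m \<noteq> \<zero> \<and> (\<Oplus>i\<in>{..m}. f i \<otimes> x [^] i) = \<zero>"
      by (rule relation_leading) (use fc x f in auto)
    then obtain m where m: "m \<le> n" "f m \<noteq> \<zero>" "(\<Oplus>i\<in>{..m}. f i \<otimes> x [^] i) = \<zero>"
      by blast
    let ?p = "map f (rev [0..<Suc m])"
    have "eval ?p x = \<zero>"
      using fc m x by (subst eval_map_upt) (auto simp: lessThan_Suc_atMost)
    moreover have "set ?p \<subseteq> A" using f(1) m(1) by auto
    moreover have "?p \<in> carrier (poly_ring R)"
      unfolding univ_poly_carrier[symmetric] polynomial_def using fc m by auto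
    ultimately show "x \<in> (\<Union>p\<in>?P. {x. is_root p x})"
      using x unfolding is_root_def by (intro UN_I[of ?p]) auto
  qed
  ultimately show ?thesis by (rule countable_subset[rotated])
qed

text \<open>The witness is the prime subring, the integer multiples of
  \<open>\<one>\<close>.\<close>

lemma (in ring) exists_countable_subring:
  obtains A where "subring A R" "countable A"
proof
  let ?A = "range (\<lambda>k::int. [k] \<cdot> \<one>)"
  show "countable ?A" by simp
  show "subring ?A R"
  proof (rule subringI)
    show "?A \<subseteq> carrier R" by auto
    show "\<one> \<in> ?A" by (rule range_eqI[of _ _ 1]) (simp add: add.int_pow_1)
    show "\<ominus> h \<in> ?A" if h: "h \<in> ?A" for h
    proof -
      obtain k :: int where "h = [k] \<cdot> \<one>" using h by blast
      then have "\<ominus> h = [(- k)] \<cdot> \<one>" by (simp add: add.int_pow_neg)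
      then show ?thesis by blast
    qed
    fix h1 h2 assume "h1 \<in> ?A" "h2 \<in> ?A"
    then obtain k l :: int where kl: "h1 = [k] \<cdot> \<one>" "h2 = [l] \<cdot> \<one>" by blast
    have "h1 \<otimes> h2 = [(l * k)] \<cdot> \<one>"
      unfolding kl by (simp add: add_pow_ldistr_int add.int_pow_pow)
    then show "h1 \<otimes> h2 \<in> ?A" by blast
    have "h1 \<oplus> h2 = [(k + l)] \<cdot> \<one>"
      unfolding kl by (simp add: add.int_pow_mult)
    then show "h1 \<oplus> h2 \<in> ?A" by blast
  qed
qed

lemma (in field) nonzero_inv:
  assumes "c \<in> carrier R" "c \<noteq> \<zero>"
  shows "inv c \<in> carrier R" "c \<otimes> inv c = \<one>" "inv c \<otimes> c = \<one>"
  using assms field_Units by (simp_all add: Units_inv_closed)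

lemma (in domain) nat_pow_nonzero:
  "\<lbrakk>c \<in> carrier R; c \<noteq> \<zero>\<rbrakk> \<Longrightarrow> c [^] (n::nat) \<noteq> \<zero>"
  by (induction n) (auto simp: integral_iff)

text \<open>Here \<open>d\<close> is \<open>1 / c\<close>, and each Horner step costs one more
  factor \<open>c\<close>. The claim covers all large exponents, so that finitely many elements
  admit a common one.\<close>

lemma (in domain) clear_denominators:
  assumes A: "subring A R" and c: "c \<in> A" and d: "d \<in> carrier R" "c \<otimes> d = \<one>"
    and y: "y \<in> simple_extension A d"
  shows "\<exists>N. \<forall>M\<ge>N. c [^] (M::nat) \<otimes> y \<in> A"
  using y
proof induction
  case zero
  then show ?case using subringE(1,2)[OF A] c by auto
next
  case (lin k1 k2)
  then obtain N where N: "\<And>M. M \<ge> N \<Longrightarrow> c [^] (M::nat) \<otimes> k1 \<in> A" by blast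
  have cc: "c \<in> carrier R" "k2 \<in> carrier R" using c lin(2) subringE(1)[OF A] by blast+
  have k1: "k1 \<in> carrier R" using lin(1) simple_extension_in_carrier[OF subringE(1)[OF A] d(1)] by blast
  have "c [^] M \<otimes> (k1 \<otimes> d \<oplus> k2) \<in> A" if M: "M \<ge> Suc N" for M
  proof -
    obtain M' where M': "M = Suc M'" "M' \<ge> N" using M by (cases M) auto
    have "c [^] M \<otimes> (k1 \<otimes> d \<oplus> k2) = (c [^] M' \<otimes> k1) \<otimes> (c \<otimes> d) \<oplus> c [^] M \<otimes> k2"
      unfolding M'(1) using cc k1 d(1) by (simp add: r_distr m_ac)
    also have "\<dots> = c [^] M' \<otimes> k1 \<oplus> c [^] M \<otimes> k2" using cc k1 d by simp
    also have "\<dots> \<in> A"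
      using N[OF M'(2)] subring_nat_pow[OF A c] lin(2) subringE(6,7)[OF A] by simp
    finally show ?thesis .
  qed
  then show ?case by blast
qed

section \<open>Subrings maximal for the transcendence of an element\<close>

context field
begin

text \<open>If \<open>1 / x\<close> were a polynomial \<open>y\<close> in \<open>x\<close>, then
  \<open>x y - 1 = 0\<close> would be a relation with constant coefficient \<open>- 1\<close>.
  Likewise \<open>x = 0\<close> would itself be a relation.\<close>

lemma alg_indep_inv:
  assumes L: "subring L R" and x: "x \<in> carrier R" "alg_indep L x"
  shows "x \<noteq> \<zero>" "inv x \<notin> simple_extension L x"
proof -
  note L' = subringE[OF L]
  have rel: "\<one> = x \<otimes> y \<Longrightarrow> y \<notin> simple_extension L x" for y
  proof
    assume xy: "\<one> = x \<otimes> y" and "y \<in> simple_extension L x"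
    then obtain n f where f: "range f \<subseteq> L" "\<And>m. m \<ge> n \<Longrightarrow> y = (\<Oplus>i\<in>{..m::nat}. f i \<otimes> x [^] i)"
      using simple_extension_finsum[OF L x(1)] by metis
    have fc: "f i \<in> carrier R" for i using f(1) L'(1) by blast
    let ?g = "\<lambda>i. case i of 0 \<Rightarrow> \<ominus> \<one> | Suc j \<Rightarrow> f j"
    have "(\<Oplus>i\<in>{..Suc n}. ?g i \<otimes> x [^] i) = (\<Oplus>i\<in>{..n}. f i \<otimes> x [^] Suc i) \<oplus> \<ominus> \<one>"
      using fc x by (subst finsum_Suc2) (auto simp: Pi_def split: nat.split)
    also have "(\<Oplus>i\<in>{..n}. f i \<otimes> x [^] Suc i) = (\<Oplus>i\<in>{..n}. (f i \<otimes> x [^] i) \<otimes> x)"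
      using fc x by (intro finsum_cong') (auto simp: m_assoc)
    also have "\<dots> = y \<otimes> x"
      unfolding f(2)[OF order_refl] using fc x by (intro finsum_ldistr[symmetric]) auto
    also have "y \<otimes> x = \<one>"
      unfolding xy using f(2)[of n] fc x by (intro m_comm) (auto intro!: finsum_closed)
    finally have "(\<Oplus>i\<in>{..Suc n}. ?g i \<otimes> x [^] i) = \<zero>" by (simp add: r_neg)
    moreover have "?g \<in> {..Suc n} \<rightarrow> L"
      using f(1) L'(3,5) by (auto simp: image_subset_iff split: nat.split)
    ultimately have "\<forall>i\<le>Suc n. ?g i = \<zero>"
      using x(2) unfolding alg_indep_def by blast
    then have "\<ominus> \<one> = \<zero>" by (metis nat.case(1) zero_le)
    then show False using r_neg[of \<one>] by simp
  qed
  show nz: "x \<noteq> \<zero>"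
  proof
    assume [simp]: "x = \<zero>"
    let ?g = "\<lambda>i::nat. if i = 0 then \<zero> else \<one>"
    have "(\<Oplus>i\<in>{..1}. ?g i \<otimes> x [^] i) = \<zero>" by simp
    moreover have "?g \<in> {..1} \<rightarrow> L" using L'(2,3) by simp
    ultimately have "\<forall>i\<le>1. ?g i = \<zero>" using x(2) unfolding alg_indep_def by blast
    then show False by (metis le_refl one_not_zero zero_neq_one)
  qed
  show "inv x \<notin> simple_extension L x"
    using nonzero_inv[OF x(1) nz] by (intro rel) simp
qed

text \<open>Clearing denominators shows that \<open>x\<close> stays transcendental over
  \<open>L[1 / c]\<close>, so maximality gives \<open>L[1 / c] = L\<close>. Hence \<open>L\<close>
  is a field.\<close>

lemma maximal_alg_indep_inv_closed:
  assumes L: "subring L R" and x: "x \<in> carrier R" "alg_indep L x"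
    and max: "\<And>B. \<lbrakk>subring B R; L \<subseteq> B; alg_indep B x\<rbrakk> \<Longrightarrow> B = L"
    and c: "c \<in> L" "c \<noteq> \<zero>"
  shows "inv c \<in> L"
proof -
  have cc: "c \<in> carrier R" using c(1) subringE(1)[OF L] by blast
  note ci = nonzero_inv[OF cc c(2)]
  let ?B = "simple_extension L (inv c)"
  note B = simple_extension_subset[OF L ci(1)]
  have "alg_indep ?B x"
    unfolding alg_indep_def
  proof (intro allI impI)
    fix n :: nat and f i
    assume f: "f \<in> {..n} \<rightarrow> ?B" "(\<Oplus>i\<in>{..n}. f i \<otimes> x [^] i) = \<zero>" and i: "i \<le> n"
    have fc: "f i \<in> carrier R" if "i \<le> n" for i using f(1) subringE(1)[OF B(1)] that by auto
    have "\<forall>i. \<exists>N. i \<le> n \<longrightarrow> (\<forall>M\<ge>N. c [^] (M::nat) \<otimes> f i \<in> L)"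
      using clear_denominators[OF L c(1) ci(1,2)] f(1) by auto
    then obtain N where N: "\<And>i M. \<lbrakk>i \<le> n; M \<ge> N i\<rbrakk> \<Longrightarrow> c [^] (M::nat) \<otimes> f i \<in> L" by metis
    let ?M = "Max (N ` {..n})"
    have "c [^] ?M \<otimes> f i \<in> L" if "i \<le> n" for i
      using that by (intro N) auto
    then have "(\<lambda>i. c [^] ?M \<otimes> f i) \<in> {..n} \<rightarrow> L" by simp
    moreover have "(\<Oplus>i\<in>{..n}. (c [^] ?M \<otimes> f i) \<otimes> x [^] i) = \<zero>"
    proof -
      have "(\<Oplus>i\<in>{..n}. (c [^] ?M \<otimes> f i) \<otimes> x [^] i) = (\<Oplus>i\<in>{..n}. c [^] ?M \<otimes> (f i \<otimes> x [^] i))"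
        using fc cc x by (intro finsum_cong') (auto simp: m_assoc)
      also have "\<dots> = c [^] ?M \<otimes> (\<Oplus>i\<in>{..n}. f i \<otimes> x [^] i)"
        using fc cc x by (intro finsum_rdistr[symmetric]) auto
      finally show ?thesis using f(2) cc by simp
    qed
    ultimately have "c [^] ?M \<otimes> f i = \<zero>"
      using x(2) i unfolding alg_indep_def by blast
    moreover have "c [^] ?M \<noteq> \<zero>" using cc c(2) by (rule nat_pow_nonzero)
    ultimately show "f i = \<zero>" using integral fc[OF i] cc by blast
  qed
  then have "?B = L" using max B by blast
  then show ?thesis using B(3) by simp
qed

text \<open>Exchanging the roles of \<open>x\<close> and \<open>k\<close> in a polynomial relation over \<open>L[k]\<close>.\<close>

lemma maximal_alg_indep_algebraic:
  assumes L: "subring L R" and x: "x \<in> carrier R" "alg_indep L x"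
    and max: "\<And>B. \<lbrakk>subring B R; L \<subseteq> B; alg_indep B x\<rbrakk> \<Longrightarrow> B = L"
    and k: "k \<in> carrier R" "k \<notin> L"
  obtains n q where "q \<in> {..n::nat} \<rightarrow> simple_extension L x" "q n \<noteq> \<zero>"
    "(\<Oplus>j\<in>{..n}. q j \<otimes> k [^] j) = \<zero>"
proof -
  note Lc = subringE(1)[OF L]
  note B = simple_extension_subset[OF L k(1)]
  have "\<not> alg_indep (simple_extension L k) x" using max B k(2) by blast
  then obtain n f i0 where f: "f \<in> {..n::nat} \<rightarrow> simple_extension L k"
    "(\<Oplus>i\<in>{..n}. f i \<otimes> x [^] i) = \<zero>" and i0: "i0 \<le> n" "f i0 \<noteq> \<zero>"
    unfolding alg_indep_def by blast
  have "\<exists>m c. range c \<subseteq> L \<and> (\<forall>M\<ge>m. f i = (\<Oplus>j\<in>{..M::nat}. c j \<otimes> k [^] j))" if "i \<le> n" for i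
  proof -
    have "f i \<in> simple_extension L k" using f(1) that by auto
    then show ?thesis by (rule simple_extension_finsum[OF L k(1)]) blast
  qed
  then obtain m c where mc: "\<And>i. i \<le> n \<Longrightarrow> range (c i) \<subseteq> L"
    "\<And>i M. \<lbrakk>i \<le> n; M \<ge> m i\<rbrakk> \<Longrightarrow> f i = (\<Oplus>j\<in>{..M::nat}. c i j \<otimes> k [^] j)"
    by metis
  define M where "M = Max (m ` {..n})"
  have fi: "f i = (\<Oplus>j\<in>{..M}. c i j \<otimes> k [^] j)" if "i \<le> n" for i
    using that unfolding M_def by (intro mc) auto
  have cL: "c i j \<in> L" if "i \<le> n" for i j using mc(1)[OF that] by blast
  then have cc: "c i j \<in> carrier R" if "i \<le> n" for i j using Lc that by blast
  \<comment> \<open>\<open>q j\<close> collects the terms with \<open>k^j\<close>; interchanging the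
    two sums gives a relation for \<open>k\<close> over \<open>L[x]\<close>.\<close>
  define q where "q j = (\<Oplus>i\<in>{..n}. c i j \<otimes> x [^] i)" for j
  have qS: "q j \<in> simple_extension L x" for j
    unfolding q_def using cL by (intro finsum_mem_simple_extension[OF L x(1)]) auto
  then have qc: "q j \<in> carrier R" for j using simple_extension_in_carrier[OF Lc x(1)] by blast
  have "(\<Oplus>j\<in>{..M}. q j \<otimes> k [^] j) = (\<Oplus>j\<in>{..M}. \<Oplus>i\<in>{..n}. (c i j \<otimes> x [^] i) \<otimes> k [^] j)"
    unfolding q_def using cc x(1) k(1)
    by (intro finsum_cong') (auto intro!: finsum_ldistr finsum_closed)
  also have "\<dots> = (\<Oplus>i\<in>{..n}. \<Oplus>j\<in>{..M}. (c i j \<otimes> x [^] i) \<otimes> k [^] j)"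
    using cc x(1) k(1) by (intro finsum_swap_atMost) auto
  also have "\<dots> = (\<Oplus>i\<in>{..n}. \<Oplus>j\<in>{..M}. (c i j \<otimes> k [^] j) \<otimes> x [^] i)"
    using cc x(1) k(1) by (intro finsum_cong') (auto intro!: finsum_closed simp: m_ac)
  also have "\<dots> = (\<Oplus>i\<in>{..n}. f i \<otimes> x [^] i)"
    using cc x(1) k(1) by (intro finsum_cong') (auto simp: fi intro!: finsum_ldistr[symmetric] finsum_closed)
  finally have rel: "(\<Oplus>j\<in>{..M}. q j \<otimes> k [^] j) = \<zero>" using f(2) by simp
  \<comment> \<open>If all \<open>q j\<close> vanished, transcendence of \<open>x\<close> over
    \<open>L\<close> would make every \<open>c i0 j\<close> zero, and with them
    \<open>f i0\<close>.\<close>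
  have "\<exists>j\<le>M. q j \<noteq> \<zero>"
  proof (rule ccontr)
    assume "\<not> (\<exists>j\<le>M. q j \<noteq> \<zero>)"
    then have q0: "q j = \<zero>" if "j \<le> M" for j using that by blast
    have "c i0 j = \<zero>" if j: "j \<le> M" for j
      using q0[OF j] cL i0(1) unfolding q_def
      by (intro alg_indepD[OF x(2), of "\<lambda>i. c i j" n]) auto
    then have "(\<Oplus>j\<in>{..M}. c i0 j \<otimes> k [^] j) = (\<Oplus>j\<in>{..M}. \<zero>)"
      using k(1) by (intro finsum_cong') auto
    then show False using fi[OF i0(1)] i0(2) by simp
  qed
  then have "\<exists>n\<le>M. q n \<noteq> \<zero> \<and> (\<Oplus>j\<in>{..n}. q j \<otimes> k [^] j) = \<zero>"
    using qc k(1) rel by (intro relation_leading) auto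
  then show ?thesis using that qS by blast
qed

end

text \<open>A polynomial expression is split at its lowest nonzero coefficient \<open>c\<close>.
  When \<open>c\<close> is a unit of the ring \<open>V\<close> below, so is the second
  factor.\<close>

lemma (in cring) simple_extension_trailing:
  assumes L: "subring L R" and x: "x \<in> carrier R" and y: "y \<in> simple_extension L x" "y \<noteq> \<zero>"
  obtains m c s where "c \<in> L" "c \<noteq> \<zero>" "s \<in> simple_extension L x" "y = x [^] (m::nat) \<otimes> (c \<oplus> x \<otimes> s)"
proof -
  have "y \<noteq> \<zero> \<longrightarrow> (\<exists>c s. \<exists>m::nat. c \<in> L \<and> c \<noteq> \<zero> \<and> s \<in> simple_extension L x \<and> y = x [^] m \<otimes> (c \<oplus> x \<otimes> s))"
    using y(1)
  proof induction
    case zero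
    then show ?case by simp
  next
    case (lin k1 k2)
    have c: "k1 \<in> carrier R" "k2 \<in> carrier R"
      using lin(1,2) simple_extension_in_carrier[OF subringE(1)[OF L] x] subringE(1)[OF L] by blast+
    show ?case
    proof (cases "k2 = \<zero>")
      case False
      have "k1 \<otimes> x \<oplus> k2 = x [^] (0::nat) \<otimes> (k2 \<oplus> x \<otimes> k1)"
        using c x by (simp add: a_comm m_comm)
      then show ?thesis using False lin(1,2) by blast
    next
      case True
      show ?thesis
      proof
        assume "k1 \<otimes> x \<oplus> k2 \<noteq> \<zero>"
        then have "k1 \<noteq> \<zero>" using True x by auto
        then obtain d s and m :: nat where d: "d \<in> L" "d \<noteq> \<zero>" "s \<in> simple_extension L x"
          "k1 = x [^] m \<otimes> (d \<oplus> x \<otimes> s)" using lin.IH by blast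
        have "d \<in> carrier R" "s \<in> carrier R"
          using d(1,3) simple_extension_in_carrier[OF subringE(1)[OF L] x] subringE(1)[OF L] by blast+
        then have "k1 \<otimes> x \<oplus> k2 = x [^] Suc m \<otimes> (d \<oplus> x \<otimes> s)"
          using True d(4) x by (simp add: m_ac)
        then show "\<exists>c s. \<exists>m::nat. c \<in> L \<and> c \<noteq> \<zero> \<and> s \<in> simple_extension L x \<and>
            k1 \<otimes> x \<oplus> k2 = x [^] m \<otimes> (c \<oplus> x \<otimes> s)"
          using d(1-3) by blast
      qed
    qed
  qed
  then show ?thesis using that y(2) by blast
qed

section \<open>Subrings of a field maximal without a given inverse\<close>

text \<open>Here \<open>x\<close> is a non-unit of \<open>V\<close>. Maximality forces
  \<open>x\<close> into the Jacobson radical of \<open>V\<close> and makes \<open>V\<close>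
  integrally closed in the field.\<close>

locale maximal_avoiding_inverse = field +
  fixes V x
  assumes subring_V: "subring V R" and x_V: "x \<in> V" and x_nonzero: "x \<noteq> \<zero>"
    and inv_x: "inv x \<notin> V"
    and maximal: "\<lbrakk>subring B R; V \<subseteq> B; inv x \<notin> B\<rbrakk> \<Longrightarrow> B = V"
begin

lemmas V_closed = subringE(2,3,5-7)[OF subring_V] subring_nat_pow[OF subring_V]

lemma V_carrier: "v \<in> V \<Longrightarrow> v \<in> carrier R"
  using subringE(1)[OF subring_V] by blast

lemma x_carrier: "x \<in> carrier R"
  using x_V by (rule V_carrier)

lemmas x_inv = nonzero_inv[OF x_carrier x_nonzero]

lemma x_mult_neq_one: "v \<in> V \<Longrightarrow> x \<otimes> v \<noteq> \<one>"
proof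
  assume v: "v \<in> V" "x \<otimes> v = \<one>"
  have "inv x = inv x \<otimes> (x \<otimes> v)" using v x_inv by simp
  also have "\<dots> = v" using V_carrier[OF v(1)] x_inv x_carrier by (simp add: m_assoc[symmetric])
  finally show False using v inv_x by simp
qed

text \<open>The form in which maximality is used from here on.\<close>

lemma inv_mem_simple_extension: "\<lbrakk>k \<in> carrier R; k \<notin> V\<rbrakk> \<Longrightarrow> inv x \<in> simple_extension V k"
  using maximal simple_extension_subset[OF subring_V] by metis

text \<open>Suppose \<open>u = c \<oplus> x \<otimes> s\<close> has no inverse in \<open>V\<close>.
  Then \<open>1 / x\<close> lies in \<open>V[1 / u]\<close>, so some \<open>u^N\<close> lies in
  \<open>x V\<close>. But \<open>u^N\<close> agrees with \<open>c^N\<close> modulo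
  \<open>x V\<close>, so the unit \<open>c^N\<close> would lie in \<open>x V\<close>, making
  \<open>x\<close> a unit of \<open>V\<close>.\<close>

lemma unit_plus_x_mult:
  assumes c: "c \<in> V" "c \<noteq> \<zero>" "inv c \<in> V" and s: "s \<in> V"
  shows "c \<oplus> x \<otimes> s \<noteq> \<zero>" "inv (c \<oplus> x \<otimes> s) \<in> V"
proof -
  let ?u = "c \<oplus> x \<otimes> s"
  have uV: "?u \<in> V" using c s x_V V_closed by simp
  note cc = V_carrier[OF c(1)] V_carrier[OF c(3)] V_carrier[OF s] V_carrier[OF uV]
  have cinv: "c \<otimes> inv c = \<one>" using nonzero_inv(2)[OF cc(1) c(2)] .
  have power: "\<exists>s'\<in>V. ?u [^] N = c [^] N \<oplus> x \<otimes> s'" for N :: nat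
  proof (induction N)
    case 0
    then show ?case using V_closed(1) x_carrier by (intro bexI[of _ \<zero>]) auto
  next
    case (Suc N)
    then obtain s' where s': "s' \<in> V" "?u [^] N = c [^] N \<oplus> x \<otimes> s'" by blast
    have "?u [^] Suc N = (c [^] N \<oplus> x \<otimes> s') \<otimes> ?u" using s' by simp
    also have "\<dots> = c [^] Suc N \<oplus> x \<otimes> (c [^] N \<otimes> s \<oplus> s' \<otimes> ?u)"
      using cc V_carrier[OF s'(1)] x_carrier by (simp add: l_distr r_distr m_ac a_ac)
    finally show ?case
      using s'(1) s uV c V_closed by (intro bexI[of _ "c [^] N \<otimes> s \<oplus> s' \<otimes> ?u"]) auto
  qed
  have no: "?u [^] N \<noteq> x \<otimes> t" if t: "t \<in> V" for N :: nat and t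
  proof
    assume eq: "?u [^] N = x \<otimes> t"
    obtain s' where s': "s' \<in> V" "?u [^] N = c [^] N \<oplus> x \<otimes> s'" using power by blast
    note tc = V_carrier[OF t] V_carrier[OF s'(1)]
    have "c [^] N = (c [^] N \<oplus> x \<otimes> s') \<oplus> \<ominus> (x \<otimes> s')"
      using cc tc x_carrier by (simp add: a_assoc r_neg)
    also have "\<dots> = x \<otimes> (t \<oplus> \<ominus> s')"
      using eq s'(2) tc x_carrier by (simp add: r_distr r_minus)
    finally have "c [^] N \<otimes> inv c [^] N = x \<otimes> ((t \<oplus> \<ominus> s') \<otimes> inv c [^] N)"
      using tc cc x_carrier by (simp add: m_assoc)
    moreover have "c [^] N \<otimes> inv c [^] N = \<one>"
      using cc cinv by (simp add: nat_pow_distrib[symmetric])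
    moreover have "(t \<oplus> \<ominus> s') \<otimes> inv c [^] N \<in> V"
      using t s'(1) c V_closed by simp
    ultimately show False using x_mult_neq_one by metis
  qed
  show nz: "?u \<noteq> \<zero>"
    using no[OF V_closed(1), of 1] cc x_carrier by auto
  note ui = nonzero_inv[OF cc(4) nz]
  show "inv ?u \<in> V"
  proof (rule ccontr)
    assume "inv ?u \<notin> V"
    then have "inv x \<in> simple_extension V (inv ?u)"
      using ui(1) by (intro inv_mem_simple_extension)
    then obtain N :: nat where N: "?u [^] N \<otimes> inv x \<in> V"
      using clear_denominators[OF subring_V uV ui(1,2)] by blast
    have "?u [^] N = x \<otimes> (?u [^] N \<otimes> inv x)"
      using cc(4) x_carrier x_inv m_lcomm[of x "?u [^] N" "inv x"] by simp
    then show False using no[OF N] by blast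
  qed
qed

text \<open>Take an integral equation of least degree \<open>m + 1\<close> for a \<open>k\<close>
  outside \<open>V\<close>. Then \<open>V[k]\<close> is spanned by \<open>1, ..., k^m\<close> and
  contains \<open>k^m / x\<close>, which gives \<open>(1 - x g) k^m = x T\<close> with
  \<open>g\<close> in \<open>V\<close> and \<open>T\<close> of lower degree in \<open>k\<close>. As
  \<open>1 - x g\<close> is a unit of \<open>V\<close>, an equation of degree \<open>m\<close>
  results.\<close>

lemma integral_mem:
  assumes k: "k \<in> carrier R" and f: "f \<in> {..<n::nat} \<rightarrow> V" "k [^] n = (\<Oplus>i\<in>{..<n}. f i \<otimes> k [^] i)"
  shows "k \<in> V"
proof (rule ccontr)
  assume kV: "k \<notin> V"
  define P where "P n \<longleftrightarrow> (\<exists>f. f \<in> {..<n::nat} \<rightarrow> V \<and> k [^] n = (\<Oplus>i\<in>{..<n}. f i \<otimes> k [^] i))" for n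
  have "P n" using f unfolding P_def by blast
  then obtain n where n: "P n" "\<And>m. m < n \<Longrightarrow> \<not> P m"
    using exists_least_iff[of P] by blast
  have "n \<noteq> 0" using n(1) unfolding P_def by (intro notI) simp
  then obtain m where m: "n = Suc m" using not0_implies_Suc by blast
  obtain f where f: "f \<in> {..<n} \<rightarrow> V" "k [^] n = (\<Oplus>i\<in>{..<n}. f i \<otimes> k [^] i)"
    using n(1) unfolding P_def by blast
  have fV: "f i \<in> V" if "i \<le> m" for i using f(1) that m by auto
  note fc = V_carrier[OF fV]
  have kf: "k [^] Suc m = (\<Oplus>i\<in>{..m}. f i \<otimes> k [^] i)"
    using f(2) unfolding m lessThan_Suc_atMost .
  \<comment> \<open>A Horner step creates the power \<open>k^(m + 1)\<close>, which
    \<open>kf\<close> rewrites in lower ones.\<close>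
  have span: "\<exists>g. (\<forall>i. g i \<in> V) \<and> y = (\<Oplus>i\<in>{..m}. g i \<otimes> k [^] i)" if "y \<in> simple_extension V k" for y
    using that
  proof induction
    case zero
    have "(\<Oplus>i\<in>{..m}. \<zero> \<otimes> k [^] i) = (\<Oplus>i\<in>{..m}. \<zero>)"
      using k by (intro finsum_cong') auto
    then show ?case using V_closed(1) by (intro exI[of _ "\<lambda>_. \<zero>"]) simp
  next
    case (lin k1 k2)
    then obtain g where g: "\<And>i. g i \<in> V" "k1 = (\<Oplus>i\<in>{..m}. g i \<otimes> k [^] i)" by blast
    note gc = V_carrier[OF g(1)] and k2 = V_carrier[OF lin(2)]
    let ?G = "\<lambda>i. case i of 0 \<Rightarrow> k2 | Suc j \<Rightarrow> g j"
    have GV: "?G i \<in> V" for i using g(1) lin(2) by (simp split: nat.split)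
    note Gc = V_carrier[OF GV]
    have "(\<Oplus>i\<in>{..m}. g i \<otimes> k [^] Suc i) = (\<Oplus>i\<in>{..m}. (g i \<otimes> k [^] i) \<otimes> k)"
      using gc k by (intro finsum_cong') (auto simp: m_assoc)
    also have "\<dots> = k1 \<otimes> k"
      unfolding g(2) using gc k by (intro finsum_ldistr[symmetric]) auto
    finally have "k1 \<otimes> k \<oplus> k2 = (\<Oplus>i\<in>{..Suc m}. ?G i \<otimes> k [^] i)"
      using gc k2 k Gc by (subst finsum_Suc2) (auto simp: Pi_def)
    also have "\<dots> = g m \<otimes> k [^] Suc m \<oplus> (\<Oplus>i\<in>{..m}. ?G i \<otimes> k [^] i)"
      using Gc k by (subst finsum_Suc) (auto simp: Pi_def)
    also have "g m \<otimes> k [^] Suc m = (\<Oplus>i\<in>{..m}. g m \<otimes> (f i \<otimes> k [^] i))"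
      unfolding kf using fc gc k by (intro finsum_rdistr) auto
    also have "\<dots> \<oplus> (\<Oplus>i\<in>{..m}. ?G i \<otimes> k [^] i)
        = (\<Oplus>i\<in>{..m}. g m \<otimes> (f i \<otimes> k [^] i) \<oplus> ?G i \<otimes> k [^] i)"
      using fc gc Gc k by (intro finsum_addf[symmetric]) auto
    \<comment> \<open>\<open>f i\<close> is known to lie in \<open>V\<close> only for
      \<open>i \<le> m\<close>; the default zero keeps all coefficients in \<open>V\<close>.\<close>
    also have "\<dots> = (\<Oplus>i\<in>{..m}. (if i \<le> m then g m \<otimes> f i \<oplus> ?G i else \<zero>) \<otimes> k [^] i)"
      using fc gc Gc k by (intro finsum_cong') (auto simp: l_distr m_assoc)
    finally show ?case
      using fV g(1) GV V_closed
      by (intro exI[of _ "\<lambda>i. if i \<le> m then g m \<otimes> f i \<oplus> ?G i else \<zero>"]) simp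
  qed
  note S = simple_extension_subset[OF subring_V k]
  have "inv x \<in> simple_extension V k" using k kV by (rule inv_mem_simple_extension)
  then have "k [^] m \<otimes> inv x \<in> simple_extension V k"
    using subringE(6)[OF S(1)] subring_nat_pow[OF S(1) S(3)] by blast
  then obtain g where g: "\<And>i. g i \<in> V" "k [^] m \<otimes> inv x = (\<Oplus>i\<in>{..m}. g i \<otimes> k [^] i)"
    using span by blast
  note gc = V_carrier[OF g(1)]
  define T where "T = (\<Oplus>i\<in>{..<m}. g i \<otimes> k [^] i)"
  have Tc: "T \<in> carrier R" unfolding T_def using gc k by (intro finsum_closed) auto
  have "(\<Oplus>i\<in>{..m}. g i \<otimes> k [^] i) = g m \<otimes> k [^] m \<oplus> T"
    unfolding T_def using gc k by (simp add: lessThan_Suc_atMost[symmetric] lessThan_Suc Pi_def)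
  then have km: "k [^] m = x \<otimes> (g m \<otimes> k [^] m \<oplus> T)"
    using g(2) k x_carrier x_inv m_lcomm[of x "k [^] m" "inv x"] by simp
  let ?u = "\<one> \<oplus> x \<otimes> (\<ominus> g m)"
  have uV: "?u \<in> V" using V_closed g(1) x_V by simp
  have u: "?u \<noteq> \<zero>" "inv ?u \<in> V"
    using V_closed g(1) by (intro unit_plus_x_mult; simp)+
  note ui = nonzero_inv[OF V_carrier[OF uV] u(1)]
  have "?u \<otimes> k [^] m = k [^] m \<oplus> \<ominus> (x \<otimes> (g m \<otimes> k [^] m))"
    using gc k x_carrier by (simp add: l_distr l_minus r_minus m_assoc)
  also have "\<dots> = x \<otimes> (g m \<otimes> k [^] m \<oplus> T) \<oplus> \<ominus> (x \<otimes> (g m \<otimes> k [^] m))"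
    using km by simp
  also have "\<dots> = x \<otimes> T"
    using gc k x_carrier Tc by (simp add: r_distr a_ac r_neg2 r_neg1 r_neg)
  finally have "inv ?u \<otimes> (?u \<otimes> k [^] m) = (inv ?u \<otimes> x) \<otimes> T"
    using ui(1) x_carrier Tc by (simp add: m_assoc)
  then have "k [^] m = (inv ?u \<otimes> x) \<otimes> T"
    using ui V_carrier[OF uV] k by (simp add: m_assoc[symmetric])
  also have "\<dots> = (\<Oplus>i\<in>{..<m}. (inv ?u \<otimes> x) \<otimes> (g i \<otimes> k [^] i))"
    unfolding T_def using ui(1) x_carrier gc k by (intro finsum_rdistr) auto
  also have "\<dots> = (\<Oplus>i\<in>{..<m}. (inv ?u \<otimes> x \<otimes> g i) \<otimes> k [^] i)"
    using ui(1) x_carrier gc k by (intro finsum_cong') (auto simp: m_assoc)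
  finally have "P m"
    unfolding P_def using u(2) x_V g(1) V_closed
    by (intro exI[of _ "\<lambda>i. inv ?u \<otimes> x \<otimes> g i"]) simp
  then show False using n(2) m by simp
qed

text \<open>Outside \<open>L\<close>, \<open>k\<close> satisfies an equation over
  \<open>L[x]\<close> with leading coefficient \<open>x^m u\<close>, where \<open>u\<close> is a
  unit of \<open>V\<close>. A power of \<open>x\<close> and \<open>1 / u\<close> turn it into a
  monic equation for \<open>x^m k\<close> over \<open>V\<close>, which is integrally closed.\<close>

lemma absorbing:
  assumes L: "subring L R" "L \<subseteq> V" "alg_indep L x"
    and max: "\<And>B. \<lbrakk>subring B R; L \<subseteq> B; alg_indep B x\<rbrakk> \<Longrightarrow> B = L"
    and k: "k \<in> carrier R"
  shows "\<exists>m::nat. x [^] m \<otimes> k \<in> V"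
proof (cases "k \<in> L")
  case True
  then have "x [^] (0::nat) \<otimes> k \<in> V" using L(2) k by auto
  then show ?thesis by blast
next
  case False
  have sub: "simple_extension L x \<subseteq> V"
    using subring_V L(2) x_V by (rule simple_extension_subring_incl)
  obtain n q where q: "q \<in> {..n::nat} \<rightarrow> simple_extension L x" "q n \<noteq> \<zero>"
    and rel: "(\<Oplus>j\<in>{..n}. q j \<otimes> k [^] j) = \<zero>"
    by (rule maximal_alg_indep_algebraic[OF L(1) x_carrier L(3) max k False])
  have qV: "q j \<in> V" if "j \<le> n" for j using q(1) sub that by auto
  note qc = V_carrier[OF qV]
  have qn': "q n \<in> simple_extension L x" using q(1) by auto
  obtain m c s where c: "c \<in> L" "c \<noteq> \<zero>" and s: "s \<in> simple_extension L x"
    and qn: "q n = x [^] (m::nat) \<otimes> (c \<oplus> x \<otimes> s)"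
    by (rule simple_extension_trailing[OF L(1) x_carrier qn' q(2)])
  let ?u = "c \<oplus> x \<otimes> s"
  have cV: "c \<in> V" and sV: "s \<in> V" using c(1) L(2) s sub by blast+
  have "inv c \<in> V"
    using maximal_alg_indep_inv_closed[OF L(1) x_carrier L(3) max c] L(2) by blast
  then have u: "?u \<noteq> \<zero>" "inv ?u \<in> V" using unit_plus_x_mult[OF cV c(2) _ sV] by blast+
  have uc: "?u \<in> carrier R" using V_carrier[OF cV] V_carrier[OF sV] x_carrier by simp
  note ui = nonzero_inv[OF uc u(1)]
  obtain N where n: "n = Suc N"
  proof (cases n)
    case 0
    then have "q 0 = \<zero>" using rel qc[of 0] by simp
    then show ?thesis using q(2) 0 by simp
  qed
  \<comment> \<open>With \<open>n = N + 1\<close>, the factor \<open>x^(m N)\<close> supplies the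
    power \<open>x^(m j)\<close> that turns \<open>k^j\<close> into \<open>(x^m k)^j\<close> for
    every \<open>j \<le> N\<close>.\<close>
  let ?z = "x [^] m \<otimes> k" and ?w = "x [^] (m * N)"
  have zc: "?z \<in> carrier R" and wc: "?w \<in> carrier R" using x_carrier k by auto
  have zpow: "?w \<otimes> k [^] j = x [^] (m * (N - j)) \<otimes> ?z [^] j" if "j \<le> N" for j
  proof -
    have "m * N = m * (N - j) + m * j" using that by (simp add: distrib_left[symmetric])
    then have "?w = x [^] (m * (N - j)) \<otimes> (x [^] m) [^] j"
      using x_carrier by (simp add: nat_pow_mult nat_pow_pow)
    then show ?thesis using x_carrier k by (simp add: nat_pow_distrib m_assoc)
  qed
  have "?z [^] n = ?w \<otimes> (x [^] m \<otimes> k [^] n)"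
    using x_carrier k zpow[of N] unfolding n by (simp add: nat_pow_distrib nat_pow_pow m_ac)
  also have "x [^] m \<otimes> k [^] n = inv ?u \<otimes> (q n \<otimes> k [^] n)"
    unfolding qn using ui uc x_carrier k by (simp add: m_assoc[symmetric]) (simp add: m_comm[of _ ?u] m_assoc[symmetric])
  also have "q n \<otimes> k [^] n = \<ominus> (\<Oplus>j\<in>{..N}. q j \<otimes> k [^] j)"
  proof (rule minus_equality[symmetric])
    show "q n \<otimes> k [^] n \<oplus> (\<Oplus>j\<in>{..N}. q j \<otimes> k [^] j) = \<zero>"
      using rel qc k unfolding n by (subst (asm) finsum_Suc) (auto simp: Pi_def)
  qed (use qc k n in \<open>auto intro!: finsum_closed\<close>)
  also have "?w \<otimes> (inv ?u \<otimes> (\<ominus> (\<Oplus>j\<in>{..N}. q j \<otimes> k [^] j)))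
      = (\<ominus> (inv ?u)) \<otimes> ?w \<otimes> (\<Oplus>j\<in>{..N}. q j \<otimes> k [^] j)"
    using ui(1) wc qc k n by (simp add: l_minus r_minus m_ac Pi_def finsum_closed)
  also have "\<dots> = (\<Oplus>j\<in>{..N}. (\<ominus> (inv ?u)) \<otimes> ?w \<otimes> (q j \<otimes> k [^] j))"
    using ui(1) wc qc k n by (intro finsum_rdistr) auto
  also have "\<dots> = (\<Oplus>j\<in>{..N}. ((\<ominus> (inv ?u)) \<otimes> q j \<otimes> x [^] (m * (N - j))) \<otimes> ?z [^] j)"
  proof (rule finsum_cong')
    fix j assume "j \<in> {..N}"
    then have j: "j \<le> N" and qj: "q j \<in> carrier R" using qc n by auto
    have "(\<ominus> (inv ?u)) \<otimes> ?w \<otimes> (q j \<otimes> k [^] j) = (\<ominus> (inv ?u)) \<otimes> q j \<otimes> (?w \<otimes> k [^] j)"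
      using ui(1) wc qj k by (simp add: m_ac)
    also have "\<dots> = ((\<ominus> (inv ?u)) \<otimes> q j \<otimes> x [^] (m * (N - j))) \<otimes> ?z [^] j"
      using ui(1) qj zc x_carrier by (simp add: zpow[OF j] m_assoc)
    finally show "(\<ominus> (inv ?u)) \<otimes> ?w \<otimes> (q j \<otimes> k [^] j) = \<dots>" .
  qed (use ui(1) qc n zc x_carrier in auto)
  finally have "?z [^] n = (\<Oplus>j\<in>{..<n}. ((\<ominus> (inv ?u)) \<otimes> q j \<otimes> x [^] (m * (N - j))) \<otimes> ?z [^] j)"
    unfolding n lessThan_Suc_atMost .
  then have "?z \<in> V"
    by (rule integral_mem[OF zc, rotated]) (use qV u(2) x_V V_closed in auto)
  then show ?thesis by blast
qed

end

theorem (in field) exists_absorbing_subring: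
  assumes A: "subring A R" and x: "x \<in> carrier R" "alg_indep A x"
  obtains V where "subring V R" "x \<in> V" "inv x \<notin> V" "\<And>k. k \<in> carrier R \<Longrightarrow> \<exists>m::nat. x [^] m \<otimes> k \<in> V"
proof -
  have chain: "alg_indep (\<Union>C) x"
    if "C \<noteq> {}" "subset.chain {B. subring B R \<and> A \<subseteq> B \<and> alg_indep B x} C" for C
    using that by (rule alg_indep_Union_chain)
  obtain L where L: "subring L R" "A \<subseteq> L" "alg_indep L x"
    and Lmax: "\<And>B. \<lbrakk>subring B R; L \<subseteq> B; alg_indep B x\<rbrakk> \<Longrightarrow> B = L"
    by (rule exists_maximal_subring_with[of A "\<lambda>B. alg_indep B x", OF A x(2) chain]) blast+
  note S = simple_extension_subset[OF L(1) x(1)]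
  obtain V where V: "subring V R" "simple_extension L x \<subseteq> V" "inv x \<notin> V"
    and Vmax: "\<And>B. \<lbrakk>subring B R; V \<subseteq> B; inv x \<notin> B\<rbrakk> \<Longrightarrow> B = V"
    by (rule exists_maximal_subring_avoiding[OF S(1) alg_indep_inv(2)[OF L(1) x(1) L(3)]]) blast+
  interpret maximal_avoiding_inverse R V x
  proof (intro maximal_avoiding_inverse.intro maximal_avoiding_inverse_axioms.intro field_axioms)
    show "x \<in> V" using V(2) S(3) by (rule subsetD)
    show "x \<noteq> \<zero>" using L(1) x(1) L(3) by (rule alg_indep_inv)
    show "B = V" if "subring B R" "V \<subseteq> B" "inv x \<notin> B" for B
      using that by (rule Vmax)
  qed (fact V)+
  show ?thesis
  proof (rule that[OF V(1) x_V V(3)])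
    have "L \<subseteq> V" using S(2) V(2) by (rule subset_trans)
    then show "\<exists>m::nat. x [^] m \<otimes> k \<in> V" if "k \<in> carrier R" for k
      using L(1,3) Lmax that by (intro absorbing)
  qed
qed

section \<open>Submaximal domains\<close>

lemma (in cring) submaximal_avoiding:
  assumes B: "subring B R" and u: "u \<in> Units R" "inv u \<notin> B"
    and absorb: "\<And>d. d \<in> carrier R \<Longrightarrow> \<exists>m::nat. u [^] m \<otimes> d \<in> B"
  shows "submaximal R"
proof -
  obtain M where M: "subring M R" "B \<subseteq> M" "inv u \<notin> M"
    and max: "\<And>T. \<lbrakk>subring T R; M \<subseteq> T; inv u \<notin> T\<rbrakk> \<Longrightarrow> T = M"
    by (rule exists_maximal_subring_avoiding[OF B u(2)]) blast+
  have uc: "u \<in> carrier R" "inv u \<in> carrier R" "inv u \<otimes> u = \<one>"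
    using u(1) by (auto intro: Units_inv_closed Units_closed)
  have "T = carrier R" if T: "subring T R" "M \<subset> T" for T
  proof -
    have inT: "inv u \<in> T" using max[OF T(1)] T(2) by blast
    have pow: "inv u [^] m \<otimes> (u [^] m \<otimes> d) = d" if d: "d \<in> carrier R" for m :: nat and d
      using d uc nat_pow_distrib[of "inv u" u m, symmetric] by (simp add: m_assoc[symmetric])
    have "d \<in> T" if d: "d \<in> carrier R" for d
    proof -
      obtain m :: nat where "u [^] m \<otimes> d \<in> B" using absorb[OF d] by blast
      then have "inv u [^] m \<otimes> (u [^] m \<otimes> d) \<in> T"
        using M(2) T(2) by (intro subringE(6)[OF T(1) subring_nat_pow[OF T(1) inT]]) blast
      then show ?thesis using pow[OF d] by simp
    qed
    then show ?thesis using subringE(1)[OF T(1)] by blast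
  qed
  moreover have "M \<subset> carrier R" using subringE(1)[OF M(1)] M(3) uc(2) by blast
  ultimately have "maximal_subring M R" unfolding maximal_subring_def using M(1) by blast
  then show ?thesis unfolding submaximal_def by blast
qed

theorem (in domain) uncountable_Units_imp_submaximal:
  assumes "uncountable (Units R)"
  shows "submaximal R"
proof -
  interpret F: field "fraction_field R" by (rule field_fraction_field)
  interpret h: ring_hom_cring R "fraction_field R" "to_fraction R"
    by (intro ring_hom_cring.intro ring_hom_cring_axioms.intro is_cring F.is_cring to_fraction_hom)
  let ?h = "to_fraction R" and ?K = "fraction_field R"
  obtain A where A: "subring A ?K" "countable A" by (rule F.exists_countable_subring)
  have "uncountable (?h ` Units R)"
    using assms inj_on_subset[OF inj_on_to_fraction Units_closed[THEN subsetI]]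
    by (metis countable_image_inj_on)
  \<comment> \<open>Some unit is transcendental over \<open>A\<close>, since only countably many
    elements are algebraic over it.\<close>
  then have "\<not> ?h ` Units R \<subseteq> {x \<in> carrier ?K. \<not> F.alg_indep A x}"
    using F.countable_algebraic[OF A] countable_subset by blast
  then obtain u where u: "u \<in> Units R" "F.alg_indep A (?h u)"
    using h.hom_closed by auto
  have uc: "u \<in> carrier R" "inv u \<in> carrier R" "u \<otimes> inv u = \<one>"
    using u(1) by (auto intro: Units_inv_closed Units_closed)
  have hu: "?h u \<in> carrier ?K" using uc(1) by simp
  obtain V where V: "subring V ?K" "?h u \<in> V" "inv\<^bsub>?K\<^esub> ?h u \<notin> V"
    "\<And>k. k \<in> carrier ?K \<Longrightarrow> \<exists>m::nat. ?h u [^]\<^bsub>?K\<^esub> m \<otimes>\<^bsub>?K\<^esub> k \<in> V"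
    by (rule F.exists_absorbing_subring[OF A(1) hu u(2)]) blast+
  \<comment> \<open>The trace of \<open>V\<close> on the domain: it lacks the inverse of
    \<open>u\<close>, and powers of \<open>u\<close> still move every element into it.\<close>
  let ?B = "{d \<in> carrier R. ?h d \<in> V}"
  have "subring ?B R"
    by (rule subringI) (use subringE[OF V(1)] in auto)
  moreover have "?h (inv u) = inv\<^bsub>?K\<^esub> ?h u"
    using uc h.hom_mult[of u "inv u"] by (intro F.comm_inv_char[symmetric]) simp_all
  then have "inv u \<notin> ?B" using V(3) by simp
  moreover have "\<exists>m::nat. u [^] m \<otimes> d \<in> ?B" if "d \<in> carrier R" for d
    using V(4)[of "?h d"] that uc(1) by auto
  ultimately show ?thesis using u(1) by (intro submaximal_avoiding)
qed

theorem proposition2p10: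
  fixes D :: "('a, 'm) ring_scheme"
  assumes "dedekind_domain D"
    and "uncountable (carrier D)"
    and "countable {M. maximalideal M D}"
  shows "uncountable (Units D) \<and> submaximal D"
proof -
  interpret dedekind_domain D by fact
  have "uncountable (Units D)" using assms(2,3) by (rule uncountable_Units)
  then show ?thesis using uncountable_Units_imp_submaximal by simp
qed

end
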